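(* The group $B_\bullet$ of parenthesized braids admits the presentation with generators $\sigma_i, a_i$ ($i\ge 1$) and relations, for all $i\ge 1$ and $j\ge i+2$, $$\sigma_i\sigma_j=\sigma_j\sigma_i,\quad \sigma_i a_j=a_j\sigma_i,\quad a_i a_{j-1}=a_j a_i,\quad a_i\sigma_{j-1}=\sigma_j a_i,$$ $$\sigma_i\sigma_{i+1}\sigma_i=\sigma_{i+1}\sigma_i\sigma_{i+1},\quad \sigma_{i+1}\sigma_i a_{i+1}=a_i\sigma_i,\quad \sigma_i\sigma_{i+1}a_i=a_{i+1}\sigma_i.$$ That is, if $\widetilde B_\bullet$ denotes the group defined by this presentation, then $\sigma_i\mapsto\sigma_i$, $a_i\mapsto a_i$ induces an isomorphism of $\widetilde B_\bullet$ onto $B_\bullet$.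
   Context: Trees. A tree is a finite rooted binary tree, either a single vertex $\bullet$ or $t_1t_2$ with left subtree $t_1$ and right subtree $t_2$. The leaves of a tree $t$ determine a dyadic subdivision of $[0,1)$: $\bullet$ gives $[0,1)$, and for $t_1t_2$ the subdivision of $t_1$ is contracted affinely to $[0,\frac12)$ and that of $t_2$ to $[\frac12,1)$. The positions of $t$ are the left endpoints of the intervals attached to all leaves of $t$ except the rightmost leaf. Every tree can be written uniquely as $t_1(t_2(\cdots(t_n\bullet)\cdots))$; one puts $\mathrm{dec}(t)=(t_1,\dots,t_n)$. Words. A word is a finite word in the letters $\sigma_i^{\pm1},a_i^{\pm1}$, $i\ge1$. There is a partial right action of words on trees: if $\mathrm{dec}(t)=(t_1,\dots,t_n)$ and $n>i$, then $\mathrm{dec}(t\cdot\sigma_i)=(t_1,\dots,t_{i-1},t_{i+1},t_i,t_{i+2},\dots,t_n)$ and $\mathrm{dec}(t\cdot a_i)=(t_1,\dots,t_{i-1},t_it_{i+1},t_{i+2},\dots,t_n)$; moreover $t\cdot w^{-1}=t'$ iff $t'\cdot w=t$, and $t\cdot(w_1w_2)=(t\cdot w_1)\cdot w_2$. Diagrams. Let $I_k=[1-2^{-(k-1)},1-2^{-k})$ for $k\ge1$. When $t\cdot\sigma_i$ is defined, $D_t(\sigma_i)$ is the braid diagram with one strand starting at each position of $t$ (top line), in which the positions lying in $I_i$ are connected, by the increasing affine bijection $I_i\to I_{i+1}$, to points of $I_{i+1}$ on the bottom line, those in $I_{i+1}$ are connected by the increasing affine bijection to points of $I_i$, and those in $I_k$,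 $k\ne i,i+1$, are connected to themselves; every strand starting in $I_i$ crosses over every strand starting in $I_{i+1}$. When $t\cdot a_i$ is defined, $D_t(a_i)$ is the diagram without crossings that connects the positions in $I_k$ ($k<i$) to themselves, maps $I_i$ affinely onto the left half of $I_i$, $I_{i+1}$ onto the right half of $I_i$, and $I_k$ onto $I_{k-1}$ for $k\ge i+2$. The final positions are those of $t\cdot\sigma_i$ and $t\cdot a_i$ respectively. For $x=\sigma_i$ or $a_i$, $D_t(x^{-1})$ is the mirror image (in a horizontal mirror) of $D_{t\cdot x^{-1}}(x)$. For a word $w$ such that $t\cdot w$ is defined, $D_t(w)$ is obtained by stacking the elementary diagrams of the successive letters of $w$: $D_t(xw')$ is $D_t(x)$ stacked over $D_{t\cdot x}(w')$. Two diagrams are isotopic (equivalent) if one can be transformed into the other by a finite sequence of Reidemeister moves of types II and III (with planar isotopies), the endpoints being kept fixed. If a tree $t'$ includes $t$ (as sets of nodes) and $D_t(w)$ exists, then $D_{t'}(w)$ exists and is obtained from $D_t(w)$ by adding strands; this completion preserves isotopy. The infinite diagram $D_\bullet(w)$ is the union (direct limit) of all diagrams $D_t(w)$ for $t$ such that $t\cdot w$ is defined; $D_\bullet(w)$ and $D_\bullet(w')$ are isotopic when for some tree $t$ the diagrams $D_t(w)$ and $D_t(w')$ are both defined and isotopic. The isotopy classes of infinite diagrams form a group under concatenation, called the group of parenthesized braids and denoted $B_\bullet$; the classes of $D_\bullet(\sigma_i)$ and $D_\bullet(a_i)$ are again denoted $\sigma_i$ and $a_i$. *)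

theory Defs
  imports Complex_Main "HOL-Algebra.Group"
begin

section \<open>Trees\<close>

datatype tree = Leaf | Node tree tree

fun leaf_ends :: "tree \<Rightarrow> real list" where
  "leaf_ends Leaf = [0]"
| "leaf_ends (Node l r) = map (\<lambda>x. x / 2) (leaf_ends l) @ map (\<lambda>x. 1/2 + x / 2) (leaf_ends r)"

definition positions :: "tree \<Rightarrow> real set" where
  "positions t = set (butlast (leaf_ends t))"

fun dec :: "tree \<Rightarrow> tree list" where
  "dec Leaf = []"
| "dec (Node l r) = l # dec r"

definition tree_of :: "tree list \<Rightarrow> tree" where
  "tree_of ts = foldr Node ts Leaf"


section \<open>Words and their partial right action on trees\<close>

text \<open>A letter pairs a generator with its sign (True for exponent \<open>1\<close>, False for \<open>-1\<close>).
  Only indices \<open>i \<ge> 1\<close> are admitted; see \<open>gens\<close>.\<close>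

datatype gen = Sig nat | Gen_a nat

type_synonym word = "(gen \<times> bool) list"

definition gens :: "gen set" where
  "gens = {Sig i |i. 1 \<le> i} \<union> {Gen_a i |i. 1 \<le> i}"

definition words_over :: "'g set \<Rightarrow> ('g \<times> bool) list set" where
  "words_over S = lists (S \<times> UNIV)"

text \<open>Lists are indexed from \<open>0\<close>, so \<open>t\<^sub>i\<close> is \<open>dec t ! (i - 1)\<close>.\<close>

fun gen_act :: "tree \<Rightarrow> gen \<Rightarrow> tree option" where
  "gen_act t (Sig i) =
     (let ts = dec t in
      if 1 \<le> i \<and> i < length ts
      then Some (tree_of (take (i - 1) ts @ [ts ! i, ts ! (i - 1)] @ drop (i + 1) ts))
      else None)"
| "gen_act t (Gen_a i) =
     (let ts = dec t in
      if 1 \<le> i \<and> i < length ts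
      then Some (tree_of (take (i - 1) ts @ [Node (ts ! (i - 1)) (ts ! i)] @ drop (i + 1) ts))
      else None)"

fun letter_act :: "tree \<Rightarrow> gen \<times> bool \<Rightarrow> tree option" where
  "letter_act t (x, True) = gen_act t x"
| "letter_act t (x, False) =
     (if \<exists>t'. gen_act t' x = Some t then Some (THE t'. gen_act t' x = Some t) else None)"

fun word_act :: "tree \<Rightarrow> word \<Rightarrow> tree option" where
  "word_act t [] = Some t"
| "word_act t (x # w) = Option.bind (letter_act t x) (\<lambda>t'. word_act t' w)"


section \<open>Braid diagrams\<close>

text \<open>A braid diagram is recorded, up to a planar isotopy that keeps the order of the heights of
  its crossings, by its starting positions on the top line, its final positions on the bottom
  line, and the list of its crossings from top to bottom. The crossing \<open>(k, b)\<close>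
  exchanges the strands that are the \<open>k\<close>-th and the \<open>(k+1)\<close>-st from the left (\<open>1 \<le> k\<close>) just above
  it; the strand coming from the left passes over if \<open>b\<close> holds, and under otherwise.\<close>

type_synonym crossing = "nat \<times> bool"

datatype diagram =
  Diagram (top_pos: "real set") (crossings: "crossing list") (bottom_pos: "real set")

definition stack :: "diagram \<Rightarrow> diagram \<Rightarrow> diagram" where
  "stack d e = Diagram (top_pos d) (crossings d @ crossings e) (bottom_pos e)"

text \<open>Seen in the mirror, the strand that was on the left above a crossing is on the right
  above it, so the over/under flag is negated although the same strand passes over.\<close>

definition mirror :: "diagram \<Rightarrow> diagram" where
  "mirror d = Diagram (bottom_pos d) (map (\<lambda>(k, b). (k, \<not> b)) (rev (crossings d))) (top_pos d)"

text \<open>The first rule is the part of planar isotopy that changes the order of heights: it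
  exchanges the heights of two consecutive crossings that share no strand. In \<open>R3\<close>, let
  \<open>x, y, z\<close> be the three strands from left to right. On both sides, \<open>a\<close>, \<open>b\<close>, \<open>c\<close> say whether
  \<open>x\<close> is over \<open>y\<close>, \<open>x\<close> over \<open>z\<close>, \<open>y\<close> over \<open>z\<close>, respectively. The side condition excludes the two
  sign patterns in which the three strands are cyclically above each other; in the six
  remaining ones the move is a Reidemeister move of type III.\<close>

inductive isotopic :: "diagram \<Rightarrow> diagram \<Rightarrow> bool" where
  planar: "k + 2 \<le> l \<or> l + 2 \<le> k \<Longrightarrow>
    isotopic (Diagram X (u @ [(k, a), (l, b)] @ v) Y) (Diagram X (u @ [(l, b), (k, a)] @ v) Y)"
| R2: "1 \<le> k \<Longrightarrow> k < card X \<Longrightarrow>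
    isotopic (Diagram X (u @ [(k, a), (k, \<not> a)] @ v) Y) (Diagram X (u @ v) Y)"
| R3: "\<not> (a = c \<and> b \<noteq> a) \<Longrightarrow>
    isotopic (Diagram X (u @ [(k, a), (k + 1, b), (k, c)] @ v) Y)
             (Diagram X (u @ [(k + 1, c), (k, b), (k + 1, a)] @ v) Y)"
| refl: "isotopic d d"
| sym: "isotopic d e \<Longrightarrow> isotopic e d"
| trans: "isotopic d e \<Longrightarrow> isotopic e f \<Longrightarrow> isotopic d f"

text \<open>The diagram that joins each \<open>x \<in> X\<close> directly to \<open>f x\<close>: two strands \<open>x < y\<close> cross, exactly
  once, iff \<open>f y < f x\<close>, and then \<open>x\<close> passes over \<open>y\<close> iff \<open>ov x y\<close>. \<open>direct_crossings f ov k xs\<close>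
  lists the crossings of the strands \<open>xs\<close> (from left to right), of which the leftmost is the \<open>k\<close>-th
  strand of the diagram: first those among the strands on the right of \<open>x\<close>, then the ones of \<open>x\<close>
  with the strands that it has to pass.\<close>

fun direct_crossings ::
  "(real \<Rightarrow> real) \<Rightarrow> (real \<Rightarrow> real \<Rightarrow> bool) \<Rightarrow> nat \<Rightarrow> real list \<Rightarrow> crossing list" where
  "direct_crossings f ov k [] = []"
| "direct_crossings f ov k (x # xs) =
     direct_crossings f ov (k + 1) xs @
     (let ys = filter (\<lambda>y. f y < f x) (sort_key f xs)
      in zip [k..<k + length ys] (map (ov x) ys))"

definition connect :: "(real \<Rightarrow> real) \<Rightarrow> (real \<Rightarrow> real \<Rightarrow> bool) \<Rightarrow> real set \<Rightarrow> diagram" where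
  "connect f ov X = Diagram X (direct_crossings f ov 1 (sorted_list_of_set X)) (f ` X)"


section \<open>The diagrams of words\<close>

definition lo :: "nat \<Rightarrow> real" where
  "lo k = 1 - 1 / 2 ^ (k - 1)"

definition I :: "nat \<Rightarrow> real set" where
  "I k = {lo k..<lo (k + 1)}"

definition interval_index :: "real \<Rightarrow> nat" where
  "interval_index x = (THE k. 1 \<le> k \<and> x \<in> I k)"

definition affine_map :: "real \<Rightarrow> real \<Rightarrow> real \<Rightarrow> real \<Rightarrow> real \<Rightarrow> real" where
  \<comment> \<open>the increasing affine bijection of \<open>[a, b)\<close> onto \<open>[c, d)\<close>\<close>
  "affine_map a b c d x = c + (x - a) * (d - c) / (b - a)"

definition affine_I :: "nat \<Rightarrow> nat \<Rightarrow> real \<Rightarrow> real" where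
  "affine_I k l = affine_map (lo k) (lo (k + 1)) (lo l) (lo (l + 1))"

definition sig_move :: "nat \<Rightarrow> real \<Rightarrow> real" where
  "sig_move i x =
     (if x \<in> I i then affine_I i (i + 1) x
      else if x \<in> I (i + 1) then affine_I (i + 1) i x
      else x)"

definition a_move :: "nat \<Rightarrow> real \<Rightarrow> real" where
  "a_move i x =
     (let k = interval_index x; mid = (lo i + lo (i + 1)) / 2 in
      if k < i then x
      else if k = i then affine_map (lo i) (lo (i + 1)) (lo i) mid x
      else if k = i + 1 then affine_map (lo (i + 1)) (lo (i + 2)) mid (lo (i + 1)) x
      else affine_I k (k - 1) x)"

text \<open>In the diagram of \<open>\<sigma>\<^sub>i\<close> the crossings are those of a strand starting in \<open>I i\<close> with one
  starting in \<open>I (i + 1)\<close>. As \<open>a_move i\<close> is increasing, the diagram of \<open>a\<^sub>i\<close> has no crossing and the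
  over/under argument is irrelevant.\<close>

fun gen_diagram :: "tree \<Rightarrow> gen \<Rightarrow> diagram" where
  "gen_diagram t (Sig i) = connect (sig_move i) (\<lambda>x y. x \<in> I i) (positions t)"
| "gen_diagram t (Gen_a i) = connect (a_move i) (\<lambda>x y. False) (positions t)"

fun letter_diagram :: "tree \<Rightarrow> gen \<times> bool \<Rightarrow> diagram" where
  "letter_diagram t (x, True) = gen_diagram t x"
| "letter_diagram t (x, False) = mirror (gen_diagram (the (letter_act t (x, False))) x)"

text \<open>\<open>D_t(w)\<close>, meaningful only when \<open>word_act t w \<noteq> None\<close>.\<close>

fun word_diagram :: "tree \<Rightarrow> word \<Rightarrow> diagram" where
  "word_diagram t [] = Diagram (positions t) [] (positions t)"
| "word_diagram t (x # w) = stack (letter_diagram t x) (word_diagram (the (letter_act t x)) w)"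


section \<open>Infinite diagrams and the group of parenthesized braids\<close>

text \<open>The infinite diagram \<open>D_\<bullet>(w)\<close> is given by the family of all finite diagrams of which it is
  the union. A finite diagram of the family is labelled by its top line, since \<open>positions\<close> is
  injective.\<close>

definition infinite_diagram :: "word \<Rightarrow> diagram set" where
  "infinite_diagram w = {word_diagram t w |t. word_act t w \<noteq> None}"

definition infinite_diagrams :: "diagram set set" where
  "infinite_diagrams = infinite_diagram ` words_over gens"

definition infinite_isotopy :: "(diagram set \<times> diagram set) set" where
  "infinite_isotopy =
     {(infinite_diagram w, infinite_diagram w') |w w'.
        w \<in> words_over gens \<and> w' \<in> words_over gens \<and>
        (\<exists>t. word_act t w \<noteq> None \<and> word_act t w' \<noteq> None \<and>
             isotopic (word_diagram t w) (word_diagram t w'))}"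

definition concatenation :: "diagram set \<Rightarrow> diagram set \<Rightarrow> diagram set" where
  "concatenation P Q = {stack d e |d e. d \<in> P \<and> e \<in> Q \<and> bottom_pos d = top_pos e}"

definition paren_braid_class :: "word \<Rightarrow> diagram set set" where
  "paren_braid_class w = infinite_isotopy `` {infinite_diagram w}"

definition paren_braid_group :: "diagram set set monoid" where
  "paren_braid_group =
     \<lparr>carrier = infinite_diagrams // infinite_isotopy,
      mult = (\<lambda>A B. infinite_isotopy `` {concatenation P Q |P Q. P \<in> A \<and> Q \<in> B}),
      one = paren_braid_class []\<rparr>"


section \<open>Groups given by a presentation\<close>

inductive_set presentation_cong ::
  "'g set \<Rightarrow> (('g \<times> bool) list \<times> ('g \<times> bool) list) set
     \<Rightarrow> (('g \<times> bool) list \<times> ('g \<times> bool) list) set"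
  for S :: "'g set" and R :: "(('g \<times> bool) list \<times> ('g \<times> bool) list) set" where
  cancel: "u \<in> words_over S \<Longrightarrow> v \<in> words_over S \<Longrightarrow> x \<in> S \<Longrightarrow>
    (u @ [(x, b), (x, \<not> b)] @ v, u @ v) \<in> presentation_cong S R"
| rel: "u \<in> words_over S \<Longrightarrow> v \<in> words_over S \<Longrightarrow> (l, r) \<in> R \<Longrightarrow>
    (u @ l @ v, u @ r @ v) \<in> presentation_cong S R"
| refl: "u \<in> words_over S \<Longrightarrow> (u, u) \<in> presentation_cong S R"
| sym: "(u, v) \<in> presentation_cong S R \<Longrightarrow> (v, u) \<in> presentation_cong S R"
| trans: "(u, v) \<in> presentation_cong S R \<Longrightarrow> (v, w) \<in> presentation_cong S R \<Longrightarrow>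
    (u, w) \<in> presentation_cong S R"

definition presented_class ::
  "'g set \<Rightarrow> (('g \<times> bool) list \<times> ('g \<times> bool) list) set
     \<Rightarrow> ('g \<times> bool) list \<Rightarrow> ('g \<times> bool) list set" where
  "presented_class S R w = presentation_cong S R `` {w}"

definition presented_group ::
  "'g set \<Rightarrow> (('g \<times> bool) list \<times> ('g \<times> bool) list) set \<Rightarrow> ('g \<times> bool) list set monoid" where
  "presented_group S R =
     \<lparr>carrier = words_over S // presentation_cong S R,
      mult = (\<lambda>A B. presentation_cong S R `` {u @ v |u v. u \<in> A \<and> v \<in> B}),
      one = presented_class S R []\<rparr>"

abbreviation \<sigma> :: "nat \<Rightarrow> gen \<times> bool" where
  "\<sigma> i \<equiv> (Sig i, True)"

abbreviation \<a> :: "nat \<Rightarrow> gen \<times> bool" where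
  "\<a> i \<equiv> (Gen_a i, True)"

definition paren_braid_relations :: "(word \<times> word) set" where
  "paren_braid_relations =
     {([\<sigma> i, \<sigma> j], [\<sigma> j, \<sigma> i]) |i j. 1 \<le> i \<and> i + 2 \<le> j} \<union>
     {([\<sigma> i, \<a> j], [\<a> j, \<sigma> i]) |i j. 1 \<le> i \<and> i + 2 \<le> j} \<union>
     {([\<a> i, \<a> (j - 1)], [\<a> j, \<a> i]) |i j. 1 \<le> i \<and> i + 2 \<le> j} \<union>
     {([\<a> i, \<sigma> (j - 1)], [\<sigma> j, \<a> i]) |i j. 1 \<le> i \<and> i + 2 \<le> j} \<union>
     {([\<sigma> i, \<sigma> (i + 1), \<sigma> i], [\<sigma> (i + 1), \<sigma> i, \<sigma> (i + 1)]) |i. 1 \<le> i} \<union>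
     {([\<sigma> (i + 1), \<sigma> i, \<a> (i + 1)], [\<a> i, \<sigma> i]) |i. 1 \<le> i} \<union>
     {([\<sigma> i, \<sigma> (i + 1), \<a> i], [\<a> (i + 1), \<sigma> i]) |i. 1 \<le> i}"

definition presented_paren_group :: "word set monoid" where
  "presented_paren_group = presented_group gens paren_braid_relations"


section \<open>Consistency of the definitions\<close>

lemma leaf_ends_bounds: "x \<in> set (leaf_ends t) \<Longrightarrow> 0 \<le> x \<and> x < 1"
  by (induction t arbitrary: x) (fastforce)+

lemma leaf_ends_nonempty [simp]: "leaf_ends t \<noteq> []"
  by (induction t) auto

lemma zero_in_leaf_ends: "0 \<in> set (leaf_ends t)"
  by (induction t) force+

lemma positions_Leaf [simp]: "positions Leaf = {}"
  by (simp add: positions_def)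

lemma positions_Node [simp]:
  "positions (Node l r) = (\<lambda>x. x / 2) ` set (leaf_ends l) \<union> (\<lambda>x. 1/2 + x / 2) ` positions r"
  by (simp add: positions_def butlast_append map_butlast[symmetric])

lemma positions_bounds: "x \<in> positions t \<Longrightarrow> 0 \<le> x \<and> x < 1"
  unfolding positions_def by (meson in_set_butlastD leaf_ends_bounds)

lemma halves_eq:
  fixes A B A' B' :: "real set"
  assumes eq: "(\<lambda>x. x / 2) ` A \<union> (\<lambda>x. 1/2 + x / 2) ` B
      = (\<lambda>x. x / 2) ` A' \<union> (\<lambda>x. 1/2 + x / 2) ` B'"
    and sub: "A \<subseteq> {0..<1}" "B \<subseteq> {0..<1}" "A' \<subseteq> {0..<1}" "B' \<subseteq> {0..<1}"
  shows "A = A' \<and> B = B'"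
proof -
  have "A = {x \<in> {0..<1}. x / 2 \<in> (\<lambda>x. x / 2) ` A \<union> (\<lambda>x. 1/2 + x / 2) ` B} \<and>
        B = {x \<in> {0..<1}. 1/2 + x / 2 \<in> (\<lambda>x. x / 2) ` A \<union> (\<lambda>x. 1/2 + x / 2) ` B}"
    if AB: "A \<subseteq> {0..<1}" "B \<subseteq> {0..<1}" for A B :: "real set"
  proof -
    have 1: "x / 2 \<noteq> 1/2 + y / 2" if "x \<in> {0..<1}" "y \<in> {0..<1}" for x y :: real
      using that by auto
    have 2: "x = y" if "x / 2 = y / 2" for x y :: real
      using that by simp
    have 3: "x = y" if "1/2 + x / 2 = 1/2 + y / 2" for x y :: real
      using that by simp
    show ?thesis
      using AB by (auto simp: image_iff dest: 1 2 3)
  qed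
  from this[OF sub(1,2)] this[OF sub(3,4)] show ?thesis
    unfolding eq by blast
qed

lemma leaf_ends_subset: "set (leaf_ends t) \<subseteq> {0..<1}"
  using leaf_ends_bounds by force

lemma positions_subset: "positions t \<subseteq> {0..<1}"
  using positions_bounds by force

lemma half_in_leaf_ends: "1/2 \<in> set (leaf_ends (Node l r))"
proof -
  have "1/2 + 0 / 2 \<in> (\<lambda>x. 1/2 + x / 2) ` set (leaf_ends r)"
    by (rule imageI) (rule zero_in_leaf_ends)
  then show ?thesis by simp
qed

lemma leaf_ends_inj: "set (leaf_ends t) = set (leaf_ends t') \<Longrightarrow> t = t'"
proof (induction t arbitrary: t')
  case Leaf
  show ?case
  proof (cases t')
    case (Node l r)
    have "1/2 \<notin> set (leaf_ends Leaf)" by simp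
    then show ?thesis using half_in_leaf_ends[of l r] Leaf Node by metis
  qed simp
next
  case (Node l r)
  show ?case
  proof (cases t')
    case Leaf
    have "1/2 \<notin> set (leaf_ends Leaf)" by simp
    then show ?thesis using half_in_leaf_ends[of l r] Node.prems Leaf by metis
  next
    case (Node l' r')
    then have "set (leaf_ends l) = set (leaf_ends l') \<and> set (leaf_ends r) = set (leaf_ends r')"
      using Node.prems by (intro halves_eq leaf_ends_subset) simp
    then show ?thesis using Node.IH Node by blast
  qed
qed

lemma positions_inj: "positions t = positions t' \<Longrightarrow> t = t'"
proof (induction t arbitrary: t')
  case Leaf
  then show ?case using zero_in_leaf_ends by (cases t') auto
next
  case (Node l r)
  show ?case
  proof (cases t')
    case Leaf
    then show ?thesis using Node.prems zero_in_leaf_ends[of l] by auto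
  next
    case (Node l' r')
    then have "set (leaf_ends l) = set (leaf_ends l') \<and> positions r = positions r'"
      using Node.prems by (intro halves_eq leaf_ends_subset positions_subset) simp
    then show ?thesis using Node.IH(2) Node leaf_ends_inj by blast
  qed
qed

lemma dec_tree_of [simp]: "dec (tree_of ts) = ts"
  by (induction ts) (auto simp: tree_of_def)

lemma tree_of_dec [simp]: "tree_of (dec t) = t"
  by (induction t) (auto simp: tree_of_def)

lemma split_two:
  assumes "1 \<le> i" "i < length ts"
  shows "ts = take (i - 1) ts @ [ts ! (i - 1), ts ! i] @ drop (i + 1) ts"
proof -
  have "ts = take (i - 1) ts @ ts ! (i - 1) # drop (Suc (i - 1)) ts"
    by (rule id_take_nth_drop) (use assms in auto)
  moreover have "drop (Suc (i - 1)) ts = ts ! i # drop (i + 1) ts"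
    using assms by (simp add: Cons_nth_drop_Suc)
  ultimately show ?thesis by simp
qed

lemma gen_act_SigE:
  assumes "gen_act t (Sig i) = Some t'"
  obtains us u v vs where "1 \<le> i" "length us = i - 1"
    "dec t = us @ [u, v] @ vs" "dec t' = us @ [v, u] @ vs"
proof -
  let ?ts = "dec t"
  have i: "1 \<le> i" "i < length ?ts"
    using assms by (auto simp: Let_def split: if_splits)
  show ?thesis
  proof (rule that)
    show "1 \<le> i" by (rule i)
    show "length (take (i - 1) ?ts) = i - 1" using i by simp
    show "?ts = take (i - 1) ?ts @ [?ts ! (i - 1), ?ts ! i] @ drop (i + 1) ?ts"
      by (rule split_two[OF i])
    show "dec t' = take (i - 1) ?ts @ [?ts ! i, ?ts ! (i - 1)] @ drop (i + 1) ?ts"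
      using assms i by (auto simp: Let_def simp del: append_Cons append_Nil)
  qed
qed

lemma gen_act_aE:
  assumes "gen_act t (Gen_a i) = Some t'"
  obtains us u v vs where "1 \<le> i" "length us = i - 1"
    "dec t = us @ [u, v] @ vs" "dec t' = us @ [Node u v] @ vs"
proof -
  let ?ts = "dec t"
  have i: "1 \<le> i" "i < length ?ts"
    using assms by (auto simp: Let_def split: if_splits)
  show ?thesis
  proof (rule that)
    show "1 \<le> i" by (rule i)
    show "length (take (i - 1) ?ts) = i - 1" using i by simp
    show "?ts = take (i - 1) ?ts @ [?ts ! (i - 1), ?ts ! i] @ drop (i + 1) ?ts"
      by (rule split_two[OF i])
    show "dec t' = take (i - 1) ?ts @ [Node (?ts ! (i - 1)) (?ts ! i)] @ drop (i + 1) ?ts"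
      using assms i by (auto simp: Let_def simp del: append_Cons append_Nil)
  qed
qed

lemma gen_act_inj:
  assumes "gen_act s x = Some t" "gen_act s' x = Some t"
  shows "s = s'"
proof -
  have "dec s = dec s'"
  proof (cases x)
    case (Sig i)
    obtain us u v vs where 1: "length us = i - 1"
      "dec s = us @ [u, v] @ vs" "dec t = us @ [v, u] @ vs"
      using assms(1) unfolding Sig by (rule gen_act_SigE)
    obtain us' u' v' vs' where 2: "length us' = i - 1"
      "dec s' = us' @ [u', v'] @ vs'" "dec t = us' @ [v', u'] @ vs'"
      using assms(2) unfolding Sig by (rule gen_act_SigE)
    from 1 2 show ?thesis by simp
  next
    case (Gen_a i)
    obtain us u v vs where 1: "length us = i - 1"
      "dec s = us @ [u, v] @ vs" "dec t = us @ [Node u v] @ vs"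
      using assms(1) unfolding Gen_a by (rule gen_act_aE)
    obtain us' u' v' vs' where 2: "length us' = i - 1"
      "dec s' = us' @ [u', v'] @ vs'" "dec t = us' @ [Node u' v'] @ vs'"
      using assms(2) unfolding Gen_a by (rule gen_act_aE)
    from 1 2 show ?thesis by simp
  qed
  then show ?thesis by (metis tree_of_dec)
qed

lemma letter_act_inverse: "letter_act t (x, \<not> b) = Some t' \<longleftrightarrow> letter_act t' (x, b) = Some t"
proof -
  have "letter_act t (x, False) = Some t' \<longleftrightarrow> gen_act t' x = Some t" for t t'
  proof (cases "\<exists>s. gen_act s x = Some t")
    case True
    then obtain s where s: "gen_act s x = Some t" by blast
    then have "(THE s. gen_act s x = Some t) = s"
      by (rule the_equality) (rule gen_act_inj[OF _ s])
    then have "letter_act t (x, False) = Some s" using True by simp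
    then show ?thesis using s by (auto dest: gen_act_inj)
  qed auto
  then show ?thesis by (cases b) auto
qed

text \<open>Performing the crossings one after the other on the list of strands brings the strands in
  the order of their images under \<open>f\<close>.\<close>

definition exchange :: "'a list \<Rightarrow> crossing \<Rightarrow> 'a list" where
  "exchange xs c = (let k = fst c in xs[k - 1 := xs ! k, k := xs ! (k - 1)])"

lemma exchange_append:
  "exchange (zs @ x # y # ys) (Suc (length zs), b) = zs @ y # x # ys"
  by (simp add: exchange_def list_update_append nth_append)

lemma foldl_exchange_pass:
  "length bs = length ys \<Longrightarrow>
   foldl exchange (zs @ x # ys @ vs) (zip [Suc (length zs)..<Suc (length zs) + length ys] bs)
   = zs @ ys @ x # vs"
proof (induction ys arbitrary: zs bs)
  case (Cons y ys)
  then obtain b bs' where bs: "bs = b # bs'" "length bs' = length ys"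
    by (cases bs) auto
  have "[Suc (length zs)..<Suc (length zs) + length (y # ys)]
      = Suc (length zs) # [Suc (length (zs @ [y]))..<Suc (length (zs @ [y])) + length ys]"
    by (simp add: upt_conv_Cons del: upt_Suc)
  then show ?case
    using Cons.IH[of bs' "zs @ [y]"] bs by (simp add: exchange_append del: upt_Suc)
qed simp

lemma insort_key_filter:
  assumes "sorted (map f ys)" "f x \<notin> f ` set ys"
  shows "insort_key f x ys = filter (\<lambda>y. f y < f x) ys @ x # filter (\<lambda>y. \<not> f y < f x) ys"
  using assms
proof (induction ys)
  case (Cons y ys)
  show ?case
  proof (cases "f y < f x")
    case True
    then show ?thesis using Cons by auto
  next
    case False
    then have "\<forall>z\<in>set ys. \<not> f z < f x" using Cons.prems by fastforce
    then have "filter (\<lambda>y. f y < f x) ys = []" "filter (\<lambda>y. \<not> f y < f x) ys = ys"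
      by (auto simp: filter_empty_conv)
    moreover have "f x \<le> f y" using False by simp
    ultimately show ?thesis using False by simp
  qed
qed simp

lemma split_sorted:
  assumes "sorted (map f ys)"
  shows "filter (\<lambda>y. f y < (c :: real)) ys @ filter (\<lambda>y. \<not> f y < c) ys = ys"
  using assms
proof (induction ys)
  case (Cons y ys)
  show ?case
  proof (cases "f y < c")
    case False
    then have "\<forall>z\<in>set ys. \<not> f z < c" using Cons.prems by fastforce
    then have "filter (\<lambda>y. f y < c) ys = []" "filter (\<lambda>y. \<not> f y < c) ys = ys"
      by (auto simp: filter_empty_conv)
    then show ?thesis using False by simp
  qed (use Cons in auto)
qed simp

lemma foldl_exchange_direct_crossings:
  assumes "distinct (map f xs)"
  shows "foldl exchange (zs @ xs) (direct_crossings f ov (Suc (length zs)) xs)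
         = zs @ sort_key f xs"
  using assms
proof (induction xs arbitrary: zs)
  case (Cons x xs)
  define ys where "ys = filter (\<lambda>y. f y < f x) (sort_key f xs)"
  define vs where "vs = filter (\<lambda>y. \<not> f y < f x) (sort_key f xs)"
  have yv: "sort_key f xs = ys @ vs"
    unfolding ys_def vs_def by (rule split_sorted[symmetric]) simp
  have "foldl exchange (zs @ x # xs) (direct_crossings f ov (Suc (length (zs @ [x]))) xs)
      = zs @ x # ys @ vs"
    using Cons.IH[of "zs @ [x]"] Cons.prems yv by simp
  moreover have "sort_key f (x # xs) = ys @ x # vs"
    using Cons.prems unfolding ys_def vs_def by (simp add: insort_key_filter)
  ultimately show ?case
    using foldl_exchange_pass[of "map (ov x) ys" ys zs x vs]
    by (simp add: Let_def ys_def[symmetric] del: upt_Suc)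
qed simp

lemma lo_diff: "1 \<le> k \<Longrightarrow> lo (k + 1) - lo k = 1 / 2 ^ k"
  by (cases k) (auto simp: lo_def field_simps)

lemma lo_less: "1 \<le> k \<Longrightarrow> lo k < lo (k + 1)"
  using lo_diff[of k] by (metis diff_gt_0_iff_gt zero_less_divide_1_iff zero_less_numeral zero_less_power)

lemma lo_mono: "1 \<le> k \<Longrightarrow> k \<le> l \<Longrightarrow> lo k \<le> lo l"
  by (auto simp: lo_def field_simps intro: power_increasing)

lemma interval_index_eq:
  assumes "1 \<le> k" "x \<in> I k"
  shows "interval_index x = k"
  unfolding interval_index_def
proof (rule the_equality)
  fix l assume l: "1 \<le> l \<and> x \<in> I l"
  then have "\<not> l + 1 \<le> k" "\<not> k + 1 \<le> l"
    using assms lo_mono[of "l + 1" k] lo_mono[of "k + 1" l] by (auto simp: I_def)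
  then show "l = k" by simp
qed (use assms in simp)

lemma affine_map_comp:
  "a < b \<Longrightarrow> c < d \<Longrightarrow> affine_map c d e f (affine_map a b c d x) = affine_map a b e f x"
  by (simp add: affine_map_def)

fun blocks :: "nat \<Rightarrow> tree list \<Rightarrow> real set" where
  "blocks k [] = {}"
| "blocks k (t # ts) =
     affine_map 0 1 (lo k) (lo (k + 1)) ` set (leaf_ends t) \<union> blocks (k + 1) ts"

lemma blocks_append: "blocks k (us @ vs) = blocks k us \<union> blocks (k + length us) vs"
  by (induction us arbitrary: k) auto

lemma affine_map_lo_half:
  assumes "1 \<le> k"
  shows "1/2 + affine_map 0 1 (lo k) (lo (k + 1)) x / 2 = affine_map 0 1 (lo (k + 1)) (lo (k + 2)) x"
  using assms by (cases k) (auto simp: lo_def affine_map_def field_simps)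

lemma blocks_half: "1 \<le> k \<Longrightarrow> (\<lambda>x. 1/2 + x / 2) ` blocks k ts = blocks (k + 1) ts"
  by (induction ts arbitrary: k)
     (simp_all add: image_Un image_image affine_map_lo_half[simplified])

lemma positions_eq_blocks: "positions t = blocks 1 (dec t)"
proof (induction t)
  case (Node l r)
  have "affine_map 0 1 (lo 1) (lo (1 + 1)) = (\<lambda>x. x / 2)"
    by (auto simp: affine_map_def lo_def)
  then show ?case
    using Node.IH(2) blocks_half[of 1 "dec r"] by (simp del: One_nat_def)
qed simp

lemma affine_block_subset:
  assumes "1 \<le> k"
  shows "affine_map 0 1 (lo k) (lo (k + 1)) ` set (leaf_ends t) \<subseteq> I k"
proof -
  have "lo k + x * (lo (k + 1) - lo k) \<in> I k" if "0 \<le> x" "x < 1" for x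
  proof -
    define c where "c = lo (k + 1) - lo k"
    have "0 < c" using lo_less[OF assms] by (simp add: c_def)
    then have "0 \<le> x * c" "x * c < c" using that by auto
    then show ?thesis unfolding c_def[symmetric] I_def by (auto simp: c_def)
  qed
  then show ?thesis using leaf_ends_bounds by (fastforce simp: affine_map_def)
qed

lemma blocks_index:
  "1 \<le> k \<Longrightarrow> x \<in> blocks k ts \<Longrightarrow> \<exists>l. k \<le> l \<and> l < k + length ts \<and> x \<in> I l"
proof (induction ts arbitrary: k)
  case (Cons t ts)
  then consider "x \<in> I k" | "x \<in> blocks (k + 1) ts"
    using affine_block_subset[of k t] by auto
  then show ?case
  proof cases
    case 2
    then obtain l where "k + 1 \<le> l" "l < k + 1 + length ts" "x \<in> I l"
      using Cons.IH[of "k + 1"] by auto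
    then show ?thesis by (intro exI[of _ l]) auto
  qed auto
qed simp

lemma I_unique: "1 \<le> k \<Longrightarrow> 1 \<le> l \<Longrightarrow> x \<in> I k \<Longrightarrow> x \<in> I l \<Longrightarrow> k = l"
  using interval_index_eq by metis

lemma sig_move_fix:
  assumes "1 \<le> k" "1 \<le> i" "i < k \<and> i + 1 < k \<or> k + length ts \<le> i"
  shows "sig_move i ` blocks k ts = blocks k ts"
proof -
  have "sig_move i x = x" if "x \<in> blocks k ts" for x
  proof -
    obtain l where l: "k \<le> l" "l < k + length ts" "x \<in> I l"
      using blocks_index[OF assms(1) \<open>x \<in> blocks k ts\<close>] by blast
    then have "x \<notin> I i" "x \<notin> I (i + 1)"
      using I_unique[of l i x] I_unique[of l "i + 1" x] assms by auto
    then show ?thesis by (simp add: sig_move_def)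
  qed
  then show ?thesis by (simp add: image_cong)
qed

lemma sig_move_left:
  assumes "1 \<le> i"
  shows "sig_move i ` affine_map 0 1 (lo i) (lo (i + 1)) ` set (leaf_ends u)
       = affine_map 0 1 (lo (i + 1)) (lo (i + 1 + 1)) ` set (leaf_ends u)"
  unfolding image_image
proof (rule image_cong)
  fix y assume "y \<in> set (leaf_ends u)"
  then have "affine_map 0 1 (lo i) (lo (i + 1)) y \<in> I i"
    using affine_block_subset[OF assms, of u] by auto
  then show "sig_move i (affine_map 0 1 (lo i) (lo (i + 1)) y)
      = affine_map 0 1 (lo (i + 1)) (lo (i + 1 + 1)) y"
    using lo_less[OF assms] by (simp add: sig_move_def affine_I_def affine_map_comp)
qed simp

lemma sig_move_right:
  assumes "1 \<le> i"
  shows "sig_move i ` affine_map 0 1 (lo (i + 1)) (lo (i + 1 + 1)) ` set (leaf_ends u)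
       = affine_map 0 1 (lo i) (lo (i + 1)) ` set (leaf_ends u)"
  unfolding image_image
proof (rule image_cong)
  fix y assume "y \<in> set (leaf_ends u)"
  then have *: "affine_map 0 1 (lo (i + 1)) (lo (i + 1 + 1)) y \<in> I (i + 1)"
    using affine_block_subset[of "i + 1" u] by auto
  then have "affine_map 0 1 (lo (i + 1)) (lo (i + 1 + 1)) y \<notin> I i"
    using I_unique[of i "i + 1"] assms by auto
  then show "sig_move i (affine_map 0 1 (lo (i + 1)) (lo (i + 1 + 1)) y)
      = affine_map 0 1 (lo i) (lo (i + 1)) y"
    using * lo_less[of "i + 1"] by (simp add: sig_move_def affine_I_def affine_map_comp)
qed simp

lemma a_move_fix:
  assumes "1 \<le> k" "k + length ts \<le> i"
  shows "a_move i ` blocks k ts = blocks k ts"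
proof -
  have "a_move i x = x" if "x \<in> blocks k ts" for x
  proof -
    obtain l where l: "k \<le> l" "l < k + length ts" "x \<in> I l"
      using blocks_index[OF assms(1) \<open>x \<in> blocks k ts\<close>] by blast
    then show ?thesis
      using interval_index_eq[of l x] assms by (simp add: a_move_def)
  qed
  then show ?thesis by (simp add: image_cong)
qed

lemma a_move_block:
  assumes "1 \<le> k" "\<And>x. x \<in> I k \<Longrightarrow> a_move i x = affine_map (lo k) (lo (k + 1)) c d x"
  shows "a_move i ` affine_map 0 1 (lo k) (lo (k + 1)) ` set (leaf_ends t)
       = affine_map 0 1 c d ` set (leaf_ends t)"
  unfolding image_image
proof (rule image_cong)
  fix y assume "y \<in> set (leaf_ends t)"
  then have "affine_map 0 1 (lo k) (lo (k + 1)) y \<in> I k"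
    using affine_block_subset[OF assms(1), of t] by auto
  then show "a_move i (affine_map 0 1 (lo k) (lo (k + 1)) y) = affine_map 0 1 c d y"
    using lo_less[OF assms(1)] by (simp add: assms(2) affine_map_comp)
qed simp

lemma a_move_shift:
  "1 \<le> i \<Longrightarrow> i + 1 \<le> k \<Longrightarrow> a_move i ` blocks (k + 1) ts = blocks k ts"
proof (induction ts arbitrary: k)
  case (Cons t ts)
  have "a_move i x = affine_map (lo (k + 1)) (lo (k + 1 + 1)) (lo k) (lo (k + 1)) x"
    if "x \<in> I (k + 1)" for x
    using interval_index_eq[of "k + 1" x] that Cons.prems by (simp add: a_move_def affine_I_def)
  then have "a_move i ` affine_map 0 1 (lo (k + 1)) (lo (k + 1 + 1)) ` set (leaf_ends t)
      = affine_map 0 1 (lo k) (lo (k + 1)) ` set (leaf_ends t)"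
    by (intro a_move_block) auto
  then show ?case
    using Cons.IH[of "k + 1"] Cons.prems by (simp add: image_Un)
qed simp

lemma affine_map_Node:
  "affine_map 0 1 a b ` set (leaf_ends (Node u v))
   = affine_map 0 1 a ((a + b) / 2) ` set (leaf_ends u) \<union>
     affine_map 0 1 ((a + b) / 2) b ` set (leaf_ends v)"
proof -
  have "affine_map 0 1 a b (x / 2) = affine_map 0 1 a ((a + b) / 2) x"
    "affine_map 0 1 a b (1/2 + x / 2) = affine_map 0 1 ((a + b) / 2) b x" for x
    by (simp_all add: affine_map_def field_simps)
  then show ?thesis by (simp add: image_Un image_image)
qed

text \<open>The diagrams of the generators end at the positions of the resulting tree.\<close>

lemma bottom_gen_diagram:
  assumes "gen_act t x = Some t'"
  shows "bottom_pos (gen_diagram t x) = positions t'"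
proof (cases x)
  case (Sig i)
  obtain us u v vs where i: "1 \<le> i" "length us = i - 1"
    and d: "dec t = us @ [u, v] @ vs" "dec t' = us @ [v, u] @ vs"
    using assms unfolding Sig by (rule gen_act_SigE)
  have "sig_move i ` blocks 1 us = blocks 1 us"
    "sig_move i ` blocks (i + 1 + 1) vs = blocks (i + 1 + 1) vs"
    by (rule sig_move_fix; use i in simp)+
  then show ?thesis
    using i d sig_move_left[of i u] sig_move_right[of i v]
    by (simp add: Sig connect_def positions_eq_blocks blocks_append image_Un Un_ac del: One_nat_def)
next
  case (Gen_a i)
  obtain us u v vs where i: "1 \<le> i" "length us = i - 1"
    and d: "dec t = us @ [u, v] @ vs" "dec t' = us @ [Node u v] @ vs"
    using assms unfolding Gen_a by (rule gen_act_aE)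
  let ?m = "(lo i + lo (i + 1)) / 2"
  have "a_move i ` blocks 1 us = blocks 1 us"
    using i by (intro a_move_fix) auto
  moreover have "a_move i ` blocks (i + 1 + 1) vs = blocks (i + 1) vs"
    using i by (intro a_move_shift) auto
  moreover have "a_move i ` affine_map 0 1 (lo i) (lo (i + 1)) ` set (leaf_ends u)
      = affine_map 0 1 (lo i) ?m ` set (leaf_ends u)"
    using i interval_index_eq[of i] by (intro a_move_block) (auto simp: a_move_def)
  moreover have "a_move i ` affine_map 0 1 (lo (i + 1)) (lo (i + 1 + 1)) ` set (leaf_ends v)
      = affine_map 0 1 ?m (lo (i + 1)) ` set (leaf_ends v)"
    using interval_index_eq[of "i + 1"] by (intro a_move_block) (auto simp: a_move_def)
  ultimately show ?thesis
    using i d affine_map_Node[of "lo i" "lo (i + 1)" u v]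
    by (simp add: Gen_a connect_def positions_eq_blocks blocks_append image_Un Un_ac
        del: One_nat_def leaf_ends.simps)
qed

lemma top_letter_diagram:
  "letter_act t x = Some t' \<Longrightarrow> top_pos (letter_diagram t x) = positions t"
proof (cases x)
  case (Pair g b)
  assume *: "letter_act t x = Some t'"
  show ?thesis
  proof (cases b)
    case True
    then show ?thesis by (cases g) (simp_all add: Pair connect_def)
  next
    case False
    then have "letter_act t (g, False) = Some t'" "gen_act t' g = Some t"
      using * Pair letter_act_inverse[of t g True t'] by auto
    then show ?thesis
      using bottom_gen_diagram False Pair
      by (simp add: mirror_def del: letter_act.simps)
  qed
qed

lemma bottom_letter_diagram:
  "letter_act t x = Some t' \<Longrightarrow> bottom_pos (letter_diagram t x) = positions t'"
proof (cases x)
  case (Pair g b)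
  assume *: "letter_act t x = Some t'"
  show ?thesis
  proof (cases b)
    case True
    then show ?thesis using * Pair bottom_gen_diagram by simp
  next
    case False
    then have "letter_act t (g, False) = Some t'" using * Pair by simp
    then show ?thesis
      using False Pair
      by (cases g) (simp_all add: mirror_def connect_def del: letter_act.simps)
  qed
qed

lemma top_word_diagram:
  "word_act t w \<noteq> None \<Longrightarrow> top_pos (word_diagram t w) = positions t"
  using top_letter_diagram
  by (cases w) (auto simp: stack_def bind_eq_Some_conv)

lemma bottom_word_diagram:
  "word_act t w = Some t' \<Longrightarrow> bottom_pos (word_diagram t w) = positions t'"
  by (induction w arbitrary: t) (auto simp: stack_def bind_eq_Some_conv)

lemma word_act_append: "word_act t (u @ v) = Option.bind (word_act t u) (\<lambda>s. word_act s v)"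
  by (induction u arbitrary: t) (auto simp: Option.bind_assoc)

lemma word_diagram_append:
  "word_act t u = Some s \<Longrightarrow> word_act s v \<noteq> None \<Longrightarrow>
   word_diagram t (u @ v) = stack (word_diagram t u) (word_diagram s v)"
proof (induction u arbitrary: t)
  case Nil
  then show ?case
    using top_word_diagram[of s v] by (cases "word_diagram s v") (auto simp: stack_def)
qed (auto simp: stack_def bind_eq_Some_conv)

lemma concatenation_infinite_diagram:
  "concatenation (infinite_diagram u) (infinite_diagram v) = infinite_diagram (u @ v)"
proof (intro equalityI subsetI)
  fix d assume "d \<in> concatenation (infinite_diagram u) (infinite_diagram v)"
  then obtain s s' t t' where
    *: "word_act s u = Some s'" "word_act t v = Some t'"
      "d = stack (word_diagram s u) (word_diagram t v)"
      "bottom_pos (word_diagram s u) = top_pos (word_diagram t v)"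
    by (auto simp: concatenation_def infinite_diagram_def)
  then have "s' = t"
    using bottom_word_diagram[of s u s'] top_word_diagram[of t v] positions_inj by simp
  then show "d \<in> infinite_diagram (u @ v)"
    using * word_diagram_append[of s u s' v]
    unfolding infinite_diagram_def by (intro CollectI exI[of _ s]) (auto simp: word_act_append)
next
  fix d assume "d \<in> infinite_diagram (u @ v)"
  then obtain s where "d = word_diagram s (u @ v)" "word_act s (u @ v) \<noteq> None"
    by (auto simp: infinite_diagram_def)
  moreover from this(2) obtain s' t' where "word_act s u = Some s'" "word_act s' v = Some t'"
    by (auto simp: word_act_append bind_eq_Some_conv)
  ultimately show "d \<in> concatenation (infinite_diagram u) (infinite_diagram v)"
    using word_diagram_append[of s u s' v] bottom_word_diagram[of s u s'] top_word_diagram[of s' v]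
    unfolding concatenation_def infinite_diagram_def by (simp, metis option.distinct(1))
qed

end

theory Submission
  imports Defs
begin

text \<open>Attach to every tree \<open>t\<close> a word \<open>C\<^sub>t\<close> in the letters \<open>a\<^sub>i\<close> that builds \<open>t\<close> from a right comb with as many
  leaves. In the presented group, \<open>C\<^sub>t w = b C\<^sub>s\<close> whenever \<open>s = t \<cdot> w\<close>, where \<open>b\<close> reads the crossings of
  \<open>D\<^sub>t(w)\<close> as letters \<open>\<sigma>\<^sub>k\<close>: this is checked on letters, where the relations involving \<open>a\<^sub>i\<close> move the
  building words through a \<open>\<sigma>\<^sub>i\<close> and turn it into a crossing of two cables. As Reidemeister moves
  preserve the class of \<open>b\<close>, isotopic diagrams come from equivalent words. Conversely, the
  relations hold for cables of strands, so equivalent words have isotopic diagrams on all large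
  trees.\<close>

section \<open>Groups given by a presentation\<close>

text \<open>The comb explains the shape of the identity. All entries of its decomposition are single
  leaves, so there the diagram of \<open>Sig k\<close> is one crossing of two neighbouring strands.
  A braid word is thus itself a word of the presented group, read on the comb: building
  \<open>t\<close> and then acting by \<open>w\<close> amounts to braiding the leaves of the comb
  and then building \<open>s\<close>. The essential work is done by the two relations with three
  letters on one side and two on the other: one splits the strand that passes over, the other the
  strand that passes under, so a crossing of two entries unfolds by induction on two trees. Two
  words with isotopic diagrams on \<open>t\<close> lead to the same tree, since the bottom line
  determines it; hence the same building words stand on both sides and cancel.\<close>

lemma words_over_simps [simp]:
  "[] \<in> words_over S"
  "x # w \<in> words_over S \<longleftrightarrow> fst x \<in> S \<and> w \<in> words_over S"
  "u @ v \<in> words_over S \<longleftrightarrow> u \<in> words_over S \<and> v \<in> words_over S"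
  by (cases x; auto simp: words_over_def)+

definition word_inv :: "('g \<times> bool) list \<Rightarrow> ('g \<times> bool) list" where
  "word_inv w = map (\<lambda>(x, b). (x, \<not> b)) (rev w)"

lemma word_inv_simps [simp]:
  "word_inv [] = []"
  "word_inv ((x, b) # w) = word_inv w @ [(x, \<not> b)]"
  "word_inv (u @ v) = word_inv v @ word_inv u"
  by (simp_all add: word_inv_def)

lemma word_inv_word_inv [simp]: "word_inv (word_inv w) = w"
  by (induction w) auto

lemma word_inv_words_over [simp]: "word_inv w \<in> words_over S \<longleftrightarrow> w \<in> words_over S"
  by (induction w) auto

locale presentation =
  fixes S :: "'g set" and R :: "(('g \<times> bool) list \<times> ('g \<times> bool) list) set"
  assumes relators: "R \<subseteq> words_over S \<times> words_over S"
begin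

definition equivalent (infix "\<approx>" 50) where
  "u \<approx> v \<longleftrightarrow> (u, v) \<in> presentation_cong S R"

lemmas equivalent_sym = presentation_cong.sym[where S = S and R = R, folded equivalent_def]
lemmas equivalent_trans [trans] = presentation_cong.trans[where S = S and R = R, folded equivalent_def]
lemmas equivalent_refl [simp] = presentation_cong.refl[where S = S and R = R, folded equivalent_def]
lemmas equivalent_cancel = presentation_cong.cancel[where S = S and R = R, folded equivalent_def]
lemmas equivalent_rel = presentation_cong.rel[where S = S and R = R, folded equivalent_def]

lemma equivalent_words: "u \<approx> v \<Longrightarrow> u \<in> words_over S \<and> v \<in> words_over S"
  unfolding equivalent_def
  by (induction rule: presentation_cong.induct) (use relators in auto)

lemma relator_equivalent: "(l, r) \<in> R \<Longrightarrow> l \<approx> r"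
  using equivalent_rel[of "[]" "[]" l r] by simp

lemma equivalent_context:
  assumes "u \<approx> v" "p \<in> words_over S" "q \<in> words_over S"
  shows "p @ u @ q \<approx> p @ v @ q"
  using assms unfolding equivalent_def
proof (induction rule: presentation_cong.induct)
  case (cancel u v x b)
  then show ?case using presentation_cong.cancel[of "p @ u" S "v @ q" x b R] by simp
next
  case (rel u v l r)
  then show ?case using presentation_cong.rel[of "p @ u" S "v @ q" l r R] by simp
qed (auto intro: presentation_cong.intros)

lemma equivalent_append:
  assumes "u \<approx> u'" "v \<approx> v'"
  shows "u @ v \<approx> u' @ v'"
  using equivalent_context[OF assms(1), of "[]" v] equivalent_context[OF assms(2), of u' "[]"]
    equivalent_words[OF assms(1)] equivalent_words[OF assms(2)]
  by (auto intro: equivalent_trans)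

lemma equivalent_inv_right: "w \<in> words_over S \<Longrightarrow> w @ word_inv w \<approx> []"
proof (induction w)
  case (Cons x w)
  obtain g b where x: "x = (g, b)" by force
  have "[x] @ (w @ word_inv w) @ [(g, \<not> b)] \<approx> [x] @ [] @ [(g, \<not> b)]"
    by (rule equivalent_context) (use Cons x in auto)
  also have "[x] @ [] @ [(g, \<not> b)] \<approx> []"
    using equivalent_cancel[of "[]" "[]" g b] Cons x by simp
  finally show ?case by (simp add: x)
qed simp

lemma equivalent_inv_left: "w \<in> words_over S \<Longrightarrow> word_inv w @ w \<approx> []"
  using equivalent_inv_right[of "word_inv w"] by simp

text \<open>Multiply by inverses at both ends. This carries identities for positive letters over to
  negative ones.\<close>

lemma equivalent_flip:
  assumes "a @ y \<approx> z @ b"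
  shows "y @ word_inv b \<approx> word_inv a @ z"
proof -
  have w: "a \<in> words_over S" "y \<in> words_over S" "z \<in> words_over S" "b \<in> words_over S"
    using equivalent_words[OF assms] by auto
  have "y @ word_inv b \<approx> word_inv a @ (a @ y) @ word_inv b"
    using equivalent_append[OF equivalent_inv_left[of a], of "y @ word_inv b"] w
    by (simp add: equivalent_sym)
  also have "word_inv a @ (a @ y) @ word_inv b \<approx> word_inv a @ (z @ b) @ word_inv b"
    by (rule equivalent_context) (use assms w in auto)
  also have "word_inv a @ (z @ b) @ word_inv b \<approx> word_inv a @ z"
    using equivalent_append[OF _ equivalent_inv_right[of b], of "word_inv a @ z"] w by simp
  finally show ?thesis .
qed

lemma equivalent_word_inv:
  assumes "u \<approx> v"
  shows "word_inv u \<approx> word_inv v"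
  using equivalent_flip[of u "[]" "[]" v] assms by (simp add: equivalent_sym)

lemma equiv_presentation_cong: "equiv (words_over S) (presentation_cong S R)"
  using equivalent_words unfolding equivalent_def
  by (auto intro!: equivI refl_onI symI transI intro: presentation_cong.intros)

lemma presented_class_eq_iff:
  "u \<in> words_over S \<Longrightarrow> v \<in> words_over S \<Longrightarrow>
   presented_class S R u = presented_class S R v \<longleftrightarrow> u \<approx> v"
  unfolding presented_class_def equivalent_def by (rule eq_equiv_class_iff[OF equiv_presentation_cong])

lemma mult_presented_class:
  assumes "u \<in> words_over S" "v \<in> words_over S"
  shows "presented_class S R u \<otimes>\<^bsub>presented_group S R\<^esub> presented_class S R v
    = presented_class S R (u @ v)"
proof -
  have "u @ v \<in> {u' @ v' |u' v'. u \<approx> u' \<and> v \<approx> v'}"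
    using assms equivalent_refl by blast
  moreover have "u \<approx> u' \<Longrightarrow> v \<approx> v' \<Longrightarrow> u' @ v' \<approx> w \<Longrightarrow> u @ v \<approx> w" for u' v' w
    by (meson equivalent_append equivalent_trans)
  ultimately show ?thesis
    by (auto 0 3 simp: presented_group_def presented_class_def equivalent_def)
qed

lemma carrier_presented_group:
  "carrier (presented_group S R) = presented_class S R ` words_over S"
  by (auto simp: presented_group_def presented_class_def quotient_def)

lemma one_presented_group: "\<one>\<^bsub>presented_group S R\<^esub> = presented_class S R []"
  by (simp add: presented_group_def)

lemma group_presented_group: "group (presented_group S R)"
proof (rule groupI; (unfold carrier_presented_group one_presented_group)?)
  fix x assume "x \<in> presented_class S R ` words_over S"
  then obtain u where u: "u \<in> words_over S" "x = presented_class S R u" by blast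
  then have "presented_class S R (word_inv u) \<otimes>\<^bsub>presented_group S R\<^esub> x = presented_class S R []"
    by (simp add: mult_presented_class presented_class_eq_iff equivalent_inv_left)
  then show "\<exists>y\<in>presented_class S R ` words_over S.
      y \<otimes>\<^bsub>presented_group S R\<^esub> x = presented_class S R []"
    using u by (intro bexI[of _ "presented_class S R (word_inv u)"]) auto
qed (auto simp: mult_presented_class)

end

section \<open>Words in the presented group\<close>

lemma Sig_in_gens [simp]: "Sig i \<in> gens \<longleftrightarrow> 1 \<le> i"
  and Gen_a_in_gens [simp]: "Gen_a i \<in> gens \<longleftrightarrow> 1 \<le> i"
  by (auto simp: gens_def)

interpretation paren: presentation gens paren_braid_relations
  by standard (auto simp: paren_braid_relations_def)

abbreviation paren_equivalent (infix "\<simeq>" 50) where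
  "u \<simeq> v \<equiv> paren.equivalent u v"

section \<open>The defining relations as commutation rules\<close>

lemma sig_sig_far: "1 \<le> i \<Longrightarrow> i + 2 \<le> j \<Longrightarrow> [\<sigma> i, \<sigma> j] \<simeq> [\<sigma> j, \<sigma> i]"
  and sig_a_far: "1 \<le> i \<Longrightarrow> i + 2 \<le> j \<Longrightarrow> [\<sigma> i, \<a> j] \<simeq> [\<a> j, \<sigma> i]"
  and sig_braid: "1 \<le> i \<Longrightarrow> [\<sigma> i, \<sigma> (i + 1), \<sigma> i] \<simeq> [\<sigma> (i + 1), \<sigma> i, \<sigma> (i + 1)]"
  and sig_sig_a: "1 \<le> i \<Longrightarrow> [\<sigma> (i + 1), \<sigma> i, \<a> (i + 1)] \<simeq> [\<a> i, \<sigma> i]"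
  and sig_sig_a': "1 \<le> i \<Longrightarrow> [\<sigma> i, \<sigma> (i + 1), \<a> i] \<simeq> [\<a> (i + 1), \<sigma> i]"
  by (rule paren.relator_equivalent; unfold paren_braid_relations_def; blast)+

text \<open>The index is shifted to \<open>Suc j\<close> to remove the subtraction
  \<open>j - 1\<close>. The orientation is the one in which a word moves to the right past
  \<open>\<a> i\<close> and its indices drop by one.\<close>

lemma a_a_far: "1 \<le> i \<Longrightarrow> i < j \<Longrightarrow> [\<a> (Suc j), \<a> i] \<simeq> [\<a> i, \<a> j]"
proof (rule paren.equivalent_sym, rule paren.relator_equivalent)
  assume "1 \<le> i" "i < j"
  then have "\<exists>i' j'. ([\<a> i, \<a> j], [\<a> (Suc j), \<a> i]) = ([\<a> i', \<a> (j' - 1)], [\<a> j', \<a> i']) \<and> 1 \<le> i' \<and> i' + 2 \<le> j'"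
    by (intro exI[of _ i] exI[of _ "Suc j"]) auto
  then show "([\<a> i, \<a> j], [\<a> (Suc j), \<a> i]) \<in> paren_braid_relations"
    unfolding paren_braid_relations_def by blast
qed

lemma sig_a_shift: "1 \<le> i \<Longrightarrow> i < j \<Longrightarrow> [\<sigma> (Suc j), \<a> i] \<simeq> [\<a> i, \<sigma> j]"
proof (rule paren.equivalent_sym, rule paren.relator_equivalent)
  assume "1 \<le> i" "i < j"
  then have "\<exists>i' j'. ([\<a> i, \<sigma> j], [\<sigma> (Suc j), \<a> i]) = ([\<a> i', \<sigma> (j' - 1)], [\<sigma> j', \<a> i']) \<and> 1 \<le> i' \<and> i' + 2 \<le> j'"
    by (intro exI[of _ i] exI[of _ "Suc j"]) auto
  then show "([\<a> i, \<sigma> j], [\<sigma> (Suc j), \<a> i]) \<in> paren_braid_relations"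
    unfolding paren_braid_relations_def by blast
qed

text \<open>Each letter may change its index while it passes \<open>g\<close>; hence the comparison
  of two words by \<open>list_all2\<close>.\<close>

lemma slide:
  assumes "list_all2 (\<lambda>x y. [x] @ g \<simeq> g @ [y]) u v" "g \<in> words_over gens"
  shows "u @ g \<simeq> g @ v"
  using assms(1)
proof (induction rule: list_all2_induct)
  case (Cons x xs y ys)
  have w: "fst x \<in> gens" "fst y \<in> gens" "ys \<in> words_over gens"
    using paren.equivalent_words[OF Cons.hyps(1)] paren.equivalent_words[OF Cons.IH] by auto
  have "[x] @ (xs @ g) \<simeq> [x] @ (g @ ys)"
    using paren.equivalent_context[OF Cons.IH, of "[x]" "[]"] w by simp
  also have "[x] @ (g @ ys) \<simeq> g @ y # ys"
    using paren.equivalent_context[OF Cons.hyps(1), of "[]" ys] w by simp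
  finally show ?case by simp
qed (use assms(2) in simp)

text \<open>The relations concern positive letters, whereas crossings carry either sign; flipping
  once for each letter covers all four cases.\<close>

lemma letter_commute:
  assumes "[(x, True), (y, True)] \<simeq> [(y, True), (x, True)]"
  shows "[(x, b), (y, c)] \<simeq> [(y, c), (x, b)]"
proof -
  have flip: "[(y, c), (x, False)] \<simeq> [(x, False), (y, c)]"
    if "[(x, True), (y, c)] \<simeq> [(y, c), (x, True)]" for x y c
    using paren.equivalent_flip[of "[(x, True)]" "[(y, c)]" "[(y, c)]" "[(x, True)]"] that by simp
  have "[(x, True), (y, c)] \<simeq> [(y, c), (x, True)]"
    using assms flip[of y x True] by (cases c) (auto intro: paren.equivalent_sym)
  then show ?thesis
    using flip[of x y c] by (cases b) (auto intro: paren.equivalent_sym)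
qed

section \<open>Crossing lists as words, and cables of parallel strands\<close>

definition braid_word :: "crossing list \<Rightarrow> word" where
  "braid_word cs = map (\<lambda>(k, b). (Sig k, b)) cs"

lemma braid_word_simps [simp]:
  "braid_word [] = []"
  "braid_word ((k, b) # cs) = (Sig k, b) # braid_word cs"
  "braid_word (cs @ ds) = braid_word cs @ braid_word ds"
  by (simp_all add: braid_word_def)

lemma braid_word_words_over: "braid_word cs \<in> words_over gens \<longleftrightarrow> (\<forall>(k, b)\<in>set cs. 1 \<le> k)"
  by (induction cs) auto

text \<open>\<open>cable k p q\<close> passes the \<open>p\<close> strands starting at the \<open>k\<close>-th one over the next \<open>q\<close> strands.\<close>

definition strand_pass :: "nat \<Rightarrow> nat \<Rightarrow> crossing list" where
  "strand_pass k q = map (\<lambda>j. (j, True)) [k..<k + q]"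

fun cable :: "nat \<Rightarrow> nat \<Rightarrow> nat \<Rightarrow> crossing list" where
  "cable k 0 q = []"
| "cable k (Suc p) q = cable (Suc k) p q @ strand_pass k q"

lemma strand_pass_0 [simp]: "strand_pass k 0 = []"
  and strand_pass_1 [simp]: "strand_pass k (Suc 0) = [(k, True)]"
  by (simp_all add: strand_pass_def)

lemma strand_pass_Suc: "strand_pass k (Suc q) = (k, True) # strand_pass (Suc k) q"
  by (simp add: strand_pass_def upt_conv_Cons del: upt_Suc)

lemma strand_pass_add: "strand_pass k (p + q) = strand_pass k p @ strand_pass (k + p) q"
  by (induction p arbitrary: k) (auto simp: strand_pass_Suc)

text \<open>An equality of lists, because \<open>cable\<close> lets the rightmost over-strands pass
  first, in the same order as \<open>direct_crossings\<close>. Additivity in the number of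
  under-strands holds only up to isotopy.\<close>

lemma cable_add: "cable k (p + p') q = cable (k + p) p' q @ cable k p q"
  by (induction p arbitrary: k) auto

lemma set_cable: "(l, b) \<in> set (cable k p q) \<Longrightarrow> k \<le> l \<and> l + 1 < k + p + q \<and> b"
  by (induction p arbitrary: k) (fastforce simp: strand_pass_def)+

lemma cable_shift:
  "list_all2 (\<lambda>(i, b) (j, c). i = j + d \<and> b = c \<and> k \<le> j) (cable (k + d) p q) (cable k p q)"
proof (induction p arbitrary: k)
  case (Suc p)
  have "list_all2 (\<lambda>(i, b) (j, c). i = j + d \<and> b = c \<and> k \<le> j)
      (strand_pass (k + d) q) (strand_pass k q)"
    by (auto simp: strand_pass_def list_all2_conv_all_nth)
  moreover have "list_all2 (\<lambda>(i, b) (j, c). i = j + d \<and> b = c \<and> k \<le> j)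
      (cable (Suc k + d) p q) (cable (Suc k) p q)"
    using Suc[of "Suc k"] by (rule list_all2_mono) auto
  ultimately show ?case by (simp add: list_all2_appendI)
qed simp

lemma braid_word_cable [simp]: "1 \<le> k \<Longrightarrow> braid_word (cable k p q) \<in> words_over gens"
  by (auto simp: braid_word_words_over dest!: set_cable)

lemma braid_word_strand_pass [simp]: "1 \<le> k \<Longrightarrow> braid_word (strand_pass k q) \<in> words_over gens"
  using braid_word_cable[of k 1 q] by simp

section \<open>Words that build trees\<close>

abbreviation leaf_count :: "tree \<Rightarrow> nat" where
  "leaf_count t \<equiv> length (leaf_ends t)"

lemma leaf_count_pos: "0 < leaf_count t"
  by simp

abbreviation leaf_total :: "tree list \<Rightarrow> nat" where
  "leaf_total ts \<equiv> sum_list (map leaf_count ts)"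

text \<open>\<open>grow k t\<close> builds the tree \<open>t\<close> as the \<open>k\<close>-th entry of a decomposition whose entries, from the
  \<open>k\<close>-th on, are single leaves; \<open>grow_all 1 (dec t)\<close> builds \<open>t\<close> from a right comb.\<close>

fun grow :: "nat \<Rightarrow> tree \<Rightarrow> word" where
  "grow k Leaf = []"
| "grow k (Node l r) = grow k l @ grow (Suc k) r @ [\<a> k]"

fun grow_all :: "nat \<Rightarrow> tree list \<Rightarrow> word" where
  "grow_all k [] = []"
| "grow_all k (t # ts) = grow k t @ grow_all (Suc k) ts"

lemma grow_all_append: "grow_all k (us @ vs) = grow_all k us @ grow_all (k + length us) vs"
  by (induction us arbitrary: k) auto

lemma set_grow: "x \<in> set (grow k t) \<Longrightarrow> \<exists>m\<ge>k. x = \<a> m"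
  by (induction t arbitrary: k) fastforce+

lemma set_grow_all: "x \<in> set (grow_all k ts) \<Longrightarrow> \<exists>m\<ge>k. x = \<a> m"
  by (induction ts arbitrary: k) (fastforce dest: set_grow)+

lemma grow_words [simp]: "1 \<le> k \<Longrightarrow> grow k t \<in> words_over gens"
  by (induction t arbitrary: k) auto

lemma grow_all_words [simp]: "1 \<le> k \<Longrightarrow> grow_all k ts \<in> words_over gens"
  by (induction ts arbitrary: k) auto

lemma grow_shift: "list_all2 (\<lambda>x y. \<exists>m\<ge>k. x = \<a> (Suc m) \<and> y = \<a> m) (grow (Suc k) t) (grow k t)"
proof (induction t arbitrary: k)
  case (Node l r)
  have "list_all2 (\<lambda>x y. \<exists>m\<ge>k. x = \<a> (Suc m) \<and> y = \<a> m) (grow (Suc (Suc k)) r) (grow (Suc k) r)"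
    using Node.IH(2)[of "Suc k"] by (rule list_all2_mono) auto
  with Node.IH(1)[of k] show ?case by (auto intro!: list_all2_appendI)
qed simp

lemma grow_all_shift:
  "list_all2 (\<lambda>x y. \<exists>m\<ge>k. x = \<a> (Suc m) \<and> y = \<a> m) (grow_all (Suc k) ts) (grow_all k ts)"
proof (induction ts arbitrary: k)
  case (Cons t ts)
  have "list_all2 (\<lambda>x y. \<exists>m\<ge>k. x = \<a> (Suc m) \<and> y = \<a> m) (grow_all (Suc (Suc k)) ts) (grow_all (Suc k) ts)"
    using Cons.IH[of "Suc k"] by (rule list_all2_mono) auto
  with grow_shift[of k t] show ?case by (auto intro!: list_all2_appendI)
qed simp

section \<open>Generators passing through building words\<close>

lemma grow_a: "1 \<le> i \<Longrightarrow> i < k \<Longrightarrow> grow (Suc k) t @ [\<a> i] \<simeq> [\<a> i] @ grow k t"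
  by (rule slide, rule list_all2_mono[OF grow_shift]) (auto intro: a_a_far)

lemma grow_all_a: "1 \<le> i \<Longrightarrow> i < k \<Longrightarrow> grow_all (Suc k) ts @ [\<a> i] \<simeq> [\<a> i] @ grow_all k ts"
  by (rule slide, rule list_all2_mono[OF grow_all_shift]) (auto intro: a_a_far)

lemma grow_sig_far: "1 \<le> i \<Longrightarrow> i + 2 \<le> k \<Longrightarrow> grow k t @ [\<sigma> i] \<simeq> [\<sigma> i] @ grow k t"
  by (rule slide) (auto simp: list_all2_same dest!: set_grow intro!: paren.equivalent_sym[OF sig_a_far])

lemma grow_all_sig_far: "1 \<le> i \<Longrightarrow> i + 2 \<le> k \<Longrightarrow> grow_all k ts @ [\<sigma> i] \<simeq> [\<sigma> i] @ grow_all k ts"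
  by (rule slide) (auto simp: list_all2_same dest!: set_grow_all intro!: paren.equivalent_sym[OF sig_a_far])

text \<open>Building \<open>t\<close> merges \<open>leaf_count t\<close> entries into one, so every
  later entry loses \<open>leaf_count t - 1\<close> from its index. Each letter \<open>\<a>\<close>
  in the word accounts for one unit of this shift.\<close>

lemma grow_sig:
  "1 \<le> j \<Longrightarrow> j \<le> m \<Longrightarrow> grow j t @ [\<sigma> (Suc m)] \<simeq> [\<sigma> (m + leaf_count t)] @ grow j t"
proof (induction t arbitrary: j m)
  case (Node l r)
  have "grow j l @ grow (Suc j) r @ [\<a> j] @ [\<sigma> (Suc m)]
      \<simeq> grow j l @ grow (Suc j) r @ [\<sigma> (Suc (Suc m))] @ [\<a> j]"
    using paren.equivalent_context[OF sig_a_shift[of j "Suc m"], of "grow j l @ grow (Suc j) r" "[]"]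
      Node.prems by (simp add: paren.equivalent_sym)
  also have "\<dots> \<simeq> grow j l @ [\<sigma> (Suc m + leaf_count r)] @ grow (Suc j) r @ [\<a> j]"
    using paren.equivalent_context[OF Node.IH(2)[of "Suc j" "Suc m"], of "grow j l" "[\<a> j]"]
      Node.prems by simp
  also have "\<dots> \<simeq> [\<sigma> (m + leaf_count r + leaf_count l)] @ grow j l @ grow (Suc j) r @ [\<a> j]"
    using paren.equivalent_context[OF Node.IH(1)[of j "m + leaf_count r"], of "[]" "grow (Suc j) r @ [\<a> j]"]
      Node.prems by simp
  finally show ?case by (simp add: ac_simps)
qed simp

lemma grow_cable:
  assumes "1 \<le> j" "j \<le> m"
  shows "grow j t @ braid_word (cable (Suc m) p q) \<simeq> braid_word (cable (m + leaf_count t) p q) @ grow j t"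
proof (rule paren.equivalent_sym, rule slide)
  obtain d where d: "leaf_count t = Suc d"
    using leaf_count_pos[of t] gr0_implies_Suc by blast
  have "list_all2 (\<lambda>x y. [x] @ grow j t \<simeq> grow j t @ [y])
      (braid_word (cable (Suc m + d) p q)) (braid_word (cable (Suc m) p q))"
    unfolding braid_word_def list_all2_map1 list_all2_map2
  proof (rule list.rel_mono_strong[OF cable_shift])
    fix x y :: crossing
    assume "(case x of (i, b) \<Rightarrow> \<lambda>(j, c). i = j + d \<and> b = c \<and> Suc m \<le> j) y" "y \<in> set (cable (Suc m) p q)"
    \<comment> \<open>Cables contain positive crossings only, so \<open>grow_sig\<close> applies to
      every letter.\<close>
    then obtain n where n: "y = (Suc n, True)" "x = (Suc n + d, True)" "m \<le> n"
      using set_cable[of _ _ "Suc m" p q] by (cases x; cases y; cases "fst y") fastforce+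
    then show "[case x of (k, b) \<Rightarrow> (Sig k, b)] @ grow j t \<simeq> grow j t @ [case y of (k, b) \<Rightarrow> (Sig k, b)]"
      using grow_sig[of j n t] assms d by (simp add: paren.equivalent_sym)
  qed
  then show "list_all2 (\<lambda>x y. [x] @ grow j t \<simeq> grow j t @ [y])
      (braid_word (cable (m + leaf_count t) p q)) (braid_word (cable (Suc m) p q))"
    using d by simp
qed (use assms in simp)

lemma grow_all_cable:
  "1 \<le> k \<Longrightarrow> grow_all k us @ braid_word (cable (k + length us) p q)
     \<simeq> braid_word (cable (k + leaf_total us) p q) @ grow_all k us"
proof (induction us arbitrary: k)
  case (Cons t us)
  have "grow k t @ grow_all (Suc k) us @ braid_word (cable (Suc k + length us) p q)
      \<simeq> grow k t @ braid_word (cable (Suc k + leaf_total us) p q) @ grow_all (Suc k) us"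
    using paren.equivalent_context[OF Cons.IH[of "Suc k"], of "grow k t" "[]"] Cons.prems by simp
  also have "\<dots> \<simeq> braid_word (cable (k + leaf_total us + leaf_count t) p q) @ grow k t @ grow_all (Suc k) us"
    using paren.equivalent_context[OF grow_cable[of k "k + leaf_total us" t p q], of "[]" "grow_all (Suc k) us"]
      Cons.prems by simp
  finally show ?case by (simp add: ac_simps)
qed simp

text \<open>One strand passes over the entry that holds \<open>v\<close>. In the induction on
  \<open>v\<close>, the relation \<open>sig_sig_a'\<close> doubles the strand underneath.\<close>

lemma grow_strand_pass:
  "1 \<le> i \<Longrightarrow> grow (Suc i) v @ [\<sigma> i] \<simeq> braid_word (strand_pass i (leaf_count v)) @ grow i v"
proof (induction v arbitrary: i)
  case (Node l r)
  let ?p = "leaf_count l" and ?q = "leaf_count r"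
  have "grow (Suc i) l @ grow (Suc (Suc i)) r @ [\<a> (Suc i)] @ [\<sigma> i]
      \<simeq> grow (Suc i) l @ grow (Suc (Suc i)) r @ [\<sigma> i] @ [\<sigma> (Suc i)] @ [\<a> i]"
    using paren.equivalent_context[OF paren.equivalent_sym[OF sig_sig_a'[of i]], of "grow (Suc i) l @ grow (Suc (Suc i)) r" "[]"]
      Node.prems by simp
  also have "\<dots> \<simeq> grow (Suc i) l @ [\<sigma> i] @ grow (Suc (Suc i)) r @ [\<sigma> (Suc i)] @ [\<a> i]"
    using paren.equivalent_context[OF grow_sig_far[of i "Suc (Suc i)" r], of "grow (Suc i) l" "[\<sigma> (Suc i)] @ [\<a> i]"]
      Node.prems by simp
  also have "\<dots> \<simeq> braid_word (strand_pass i ?p) @ grow i l @ grow (Suc (Suc i)) r @ [\<sigma> (Suc i)] @ [\<a> i]"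
    using paren.equivalent_context[OF Node.IH(1)[of i], of "[]" "grow (Suc (Suc i)) r @ [\<sigma> (Suc i)] @ [\<a> i]"]
      Node.prems by simp
  also have "\<dots> \<simeq> braid_word (strand_pass i ?p) @ grow i l @ braid_word (strand_pass (Suc i) ?q) @ grow (Suc i) r @ [\<a> i]"
    using paren.equivalent_context[OF Node.IH(2)[of "Suc i"], of "braid_word (strand_pass i ?p) @ grow i l" "[\<a> i]"]
      Node.prems by simp
  also have "\<dots> \<simeq> braid_word (strand_pass i ?p) @ braid_word (strand_pass (i + ?p) ?q) @ grow i l @ grow (Suc i) r @ [\<a> i]"
    using paren.equivalent_context[OF grow_cable[of i i l 1 ?q], of "braid_word (strand_pass i ?p)" "grow (Suc i) r @ [\<a> i]"]
      Node.prems by simp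
  finally show ?case by (simp add: strand_pass_add)
qed simp

text \<open>Induction on the tree that passes over: \<open>sig_sig_a\<close> doubles the upper
  strand, and a single upper strand is the case of \<open>grow_strand_pass\<close>. The right half
  of the tree crosses first, in accordance with \<open>cable_add\<close>.\<close>

lemma grow_grow_sig:
  "1 \<le> i \<Longrightarrow> grow i u @ grow (Suc i) v @ [\<sigma> i]
     \<simeq> braid_word (cable i (leaf_count u) (leaf_count v)) @ grow i v @ grow (Suc i) u"
proof (induction u arbitrary: i)
  case Leaf
  then show ?case using grow_strand_pass[of i v] by simp
next
  case (Node l r)
  let ?p = "leaf_count l" and ?p' = "leaf_count r" and ?q = "leaf_count v"
  have "grow i l @ grow (Suc i) r @ [\<a> i] @ grow (Suc i) v @ [\<sigma> i]
      \<simeq> grow i l @ grow (Suc i) r @ grow (Suc (Suc i)) v @ [\<a> i] @ [\<sigma> i]"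
    using paren.equivalent_context[OF paren.equivalent_sym[OF grow_a[of i "Suc i" v]], of "grow i l @ grow (Suc i) r" "[\<sigma> i]"]
      Node.prems by simp
  also have "\<dots> \<simeq> grow i l @ grow (Suc i) r @ grow (Suc (Suc i)) v @ [\<sigma> (Suc i)] @ [\<sigma> i] @ [\<a> (Suc i)]"
    using paren.equivalent_context[OF paren.equivalent_sym[OF sig_sig_a[of i]], of "grow i l @ grow (Suc i) r @ grow (Suc (Suc i)) v" "[]"]
      Node.prems by simp
  also have "\<dots> \<simeq> grow i l @ braid_word (cable (Suc i) ?p' ?q) @ grow (Suc i) v @ grow (Suc (Suc i)) r @ [\<sigma> i] @ [\<a> (Suc i)]"
    using paren.equivalent_context[OF Node.IH(2)[of "Suc i"], of "grow i l" "[\<sigma> i] @ [\<a> (Suc i)]"]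
      Node.prems by simp
  also have "\<dots> \<simeq> grow i l @ braid_word (cable (Suc i) ?p' ?q) @ grow (Suc i) v @ [\<sigma> i] @ grow (Suc (Suc i)) r @ [\<a> (Suc i)]"
    using paren.equivalent_context[OF grow_sig_far[of i "Suc (Suc i)" r],
        of "grow i l @ braid_word (cable (Suc i) ?p' ?q) @ grow (Suc i) v" "[\<a> (Suc i)]"]
      Node.prems by simp
  also have "\<dots> \<simeq> braid_word (cable (i + ?p) ?p' ?q) @ grow i l @ grow (Suc i) v @ [\<sigma> i] @ grow (Suc (Suc i)) r @ [\<a> (Suc i)]"
    using paren.equivalent_context[OF grow_cable[of i i l ?p' ?q],
        of "[]" "grow (Suc i) v @ [\<sigma> i] @ grow (Suc (Suc i)) r @ [\<a> (Suc i)]"]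
      Node.prems by simp
  also have "\<dots> \<simeq> braid_word (cable (i + ?p) ?p' ?q) @ braid_word (cable i ?p ?q) @ grow i v @ grow (Suc i) l @ grow (Suc (Suc i)) r @ [\<a> (Suc i)]"
    using paren.equivalent_context[OF Node.IH(1)[of i],
        of "braid_word (cable (i + ?p) ?p' ?q)" "grow (Suc (Suc i)) r @ [\<a> (Suc i)]"]
      Node.prems by simp
  finally show ?case by (simp add: cable_add)
qed

text \<open>Nothing crosses here, so no braid appears: \<open>\<a> i\<close> moves left past the
  entries behind it and becomes the last letter that builds \<open>Node u v\<close>.\<close>

lemma grow_all_a_act:
  assumes "1 \<le> i" "length us = i - 1"
  shows "grow_all 1 (us @ [u, v] @ vs) @ [\<a> i] \<simeq> grow_all 1 (us @ [Node u v] @ vs)"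
  using paren.equivalent_context[OF grow_all_a[of i "Suc i" vs], of "grow_all 1 us @ grow i u @ grow (Suc i) v" "[]"] assms
  by (simp add: grow_all_append)

lemma grow_all_sig_act:
  assumes "1 \<le> i" "length us = i - 1"
  shows "grow_all 1 (us @ [u, v] @ vs) @ [\<sigma> i]
    \<simeq> braid_word (cable (1 + leaf_total us) (leaf_count u) (leaf_count v)) @ grow_all 1 (us @ [v, u] @ vs)"
proof -
  let ?c = "\<lambda>k. braid_word (cable k (leaf_count u) (leaf_count v))"
  have "grow_all 1 us @ grow i u @ grow (Suc i) v @ grow_all (Suc (Suc i)) vs @ [\<sigma> i]
      \<simeq> grow_all 1 us @ grow i u @ grow (Suc i) v @ [\<sigma> i] @ grow_all (Suc (Suc i)) vs"
    using paren.equivalent_context[OF grow_all_sig_far[of i "Suc (Suc i)" vs],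
        of "grow_all 1 us @ grow i u @ grow (Suc i) v" "[]"] assms by simp
  also have "\<dots> \<simeq> grow_all 1 us @ ?c i @ grow i v @ grow (Suc i) u @ grow_all (Suc (Suc i)) vs"
    using paren.equivalent_context[OF grow_grow_sig[of i u v],
        of "grow_all 1 us" "grow_all (Suc (Suc i)) vs"] assms by simp
  also have "\<dots> \<simeq> ?c (1 + leaf_total us) @ grow_all 1 us @ grow i v @ grow (Suc i) u @ grow_all (Suc (Suc i)) vs"
    using paren.equivalent_context[OF grow_all_cable[of 1 us "leaf_count u" "leaf_count v"],
        of "[]" "grow i v @ grow (Suc i) u @ grow_all (Suc (Suc i)) vs"] assms by simp
  finally show ?thesis using assms by (simp add: grow_all_append)
qed

section \<open>Moves of diagrams as identities in the presented group\<close>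

lemma braid_word_planar:
  assumes "1 \<le> k" "1 \<le> l" "k + 2 \<le> l \<or> l + 2 \<le> k"
  shows "braid_word [(k, a), (l, b)] \<simeq> braid_word [(l, b), (k, a)]"
  using assms sig_sig_far[of k l] sig_sig_far[of l k]
  by (auto intro: letter_commute paren.equivalent_sym)

text \<open>The side condition leaves six sign patterns. Moving one letter of the braid relation to
  the other side yields two mixed patterns, and formal inverses of these three identities give the
  rest.\<close>

lemma braid_word_R3:
  assumes "1 \<le> k" "\<not> (a = c \<and> b \<noteq> a)"
  shows "braid_word [(k, a), (k + 1, b), (k, c)] \<simeq> braid_word [(k + 1, c), (k, b), (k + 1, a)]"
proof -
  let ?s = "\<lambda>k b. (Sig k, b)"
  have TTT: "[\<sigma> k, \<sigma> (k + 1), \<sigma> k] \<simeq> [\<sigma> (k + 1), \<sigma> k, \<sigma> (k + 1)]"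
    using sig_braid assms(1) .
  have TTF: "[\<sigma> k, \<sigma> (k + 1), ?s k False] \<simeq> [?s (k + 1) False, \<sigma> k, \<sigma> (k + 1)]"
    using paren.equivalent_flip[of "[\<sigma> (k + 1)]" "[\<sigma> k, \<sigma> (k + 1)]" "[\<sigma> k, \<sigma> (k + 1)]" "[\<sigma> k]"]
      paren.equivalent_sym[OF TTT] by simp
  have FTT: "[?s k False, \<sigma> (k + 1), \<sigma> k] \<simeq> [\<sigma> (k + 1), \<sigma> k, ?s (k + 1) False]"
    using paren.equivalent_flip[of "[\<sigma> k]" "[\<sigma> (k + 1), \<sigma> k]" "[\<sigma> (k + 1), \<sigma> k]" "[\<sigma> (k + 1)]"]
      TTT by (simp add: paren.equivalent_sym)
  show ?thesis
    using assms(2) TTT TTF FTT paren.equivalent_word_inv[OF TTT] paren.equivalent_word_inv[OF TTF]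
      paren.equivalent_word_inv[OF FTT]
    by (cases a; cases b; cases c) (simp_all add: paren.equivalent_sym)
qed

text \<open>The rules \<open>planar\<close> and \<open>R3\<close> do not exclude the index
  \<open>0\<close>, which is no generator. Membership in \<open>words_over gens\<close> is therefore
  carried along as an invariant, so that the induction passes through symmetry and
  transitivity.\<close>

lemma isotopic_braid_word:
  assumes "isotopic d e"
  shows "top_pos d = top_pos e \<and> bottom_pos d = bottom_pos e \<and>
    (braid_word (crossings d) \<in> words_over gens \<longleftrightarrow> braid_word (crossings e) \<in> words_over gens) \<and>
    (braid_word (crossings d) \<in> words_over gens \<longrightarrow>
      braid_word (crossings d) \<simeq> braid_word (crossings e))"
  using assms
proof (induction rule: isotopic.induct)
  case (planar k l X u a b v Y)
  then show ?case
    using paren.equivalent_context[OF braid_word_planar[of k l a b], of "braid_word u" "braid_word v"]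
    by auto
next
  case (R2 k X u a v Y)
  then show ?case
    using paren.equivalent_cancel[of "braid_word u" "braid_word v" "Sig k" a]
    by auto
next
  case (R3 a c b X u k v Y)
  then show ?case
    using paren.equivalent_context[OF braid_word_R3[of k a c b], of "braid_word u" "braid_word v"]
    by auto
next
  case (sym d e)
  then show ?case by (auto intro: paren.equivalent_sym)
next
  case (trans d e f)
  then show ?case by (auto intro: paren.equivalent_trans)
qed simp

section \<open>The crossings of the diagrams of the generators\<close>

text \<open>Strands that end up to the left of all later ones meet no crossing; they only shift the
  numbering.\<close>

lemma direct_crossings_sorted_append:
  assumes "sorted (map f xs)" "\<forall>x\<in>set xs. \<forall>y\<in>set ys. f x \<le> f y"
  shows "direct_crossings f ov k (xs @ ys) = direct_crossings f ov (k + length xs) ys"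
  using assms
proof (induction xs arbitrary: k)
  case (Cons x xs)
  then have "filter (\<lambda>y. f y < f x) (sort_key f (xs @ ys)) = []"
    by (auto simp: filter_empty_conv not_less)
  then show ?case using Cons by (simp add: Let_def)
qed simp

lemma direct_crossings_sorted: "sorted (map f xs) \<Longrightarrow> direct_crossings f ov k xs = []"
  using direct_crossings_sorted_append[of f xs "[]" ov k] by simp

text \<open>Each strand of \<open>xs\<close> has to pass exactly \<open>ys\<close>, and
  \<open>direct_crossings\<close> treats the rightmost of them first, which is the recursion of
  \<open>cable\<close>.\<close>

lemma direct_crossings_swap:
  assumes "sorted (map f xs)" "sorted (map f (ys @ zs))"
    "\<forall>x\<in>set xs. \<forall>y\<in>set ys. f y < f x \<and> ov x y" "\<forall>x\<in>set xs. \<forall>z\<in>set zs. f x \<le> f z"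
  shows "direct_crossings f ov k (xs @ ys @ zs) = cable k (length xs) (length ys)"
  using assms
proof (induction xs arbitrary: k)
  case Nil
  then show ?case by (simp add: direct_crossings_sorted)
next
  case (Cons x xs)
  have "filter (\<lambda>y. f y < f x) xs = []" "filter (\<lambda>y. f y < f x) ys = ys" "filter (\<lambda>y. f y < f x) zs = []"
    using Cons.prems by (auto simp: filter_empty_conv not_less filter_id_conv)
  moreover have "sorted (map f ys)" using Cons.prems by (simp add: sorted_append)
  ultimately have "filter (\<lambda>y. f y < f x) (sort_key f (xs @ ys @ zs)) = ys"
    by (simp add: filter_sort sort_key_id_if_sorted)
  moreover have "map (ov x) ys = replicate (length ys) True"
    using Cons.prems by (simp add: list_eq_iff_nth_eq)
  ultimately show ?case
    using Cons by (simp add: Let_def zip_replicate2 strand_pass_def del: upt_Suc)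
qed

section \<open>The strands from left to right, interval by interval\<close>

lemma sorted_wrt_leaf_ends: "sorted_wrt (<) (leaf_ends t)"
proof (induction t)
  case (Node l r)
  have "x / 2 < 1/2 + y / 2" if "x \<in> set (leaf_ends l)" "y \<in> set (leaf_ends r)" for x y
    using leaf_ends_bounds[OF that(1)] leaf_ends_bounds[OF that(2)] by simp
  then show ?case using Node by (simp add: sorted_wrt_append sorted_wrt_map)
qed simp

lemma affine_map_strict_mono: "a < b \<Longrightarrow> c < d \<Longrightarrow> x < y \<Longrightarrow> affine_map a b c d x < affine_map a b c d y"
  by (simp add: affine_map_def divide_strict_right_mono mult_strict_right_mono)

lemma affine_map_left: "affine_map a b c d a = c"
  and affine_map_right: "a < b \<Longrightarrow> affine_map a b c d b = d"
  by (simp_all add: affine_map_def)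

lemma affine_map_bounds:
  assumes "a < b" "c < d" "x \<in> {a..<b}"
  shows "c \<le> affine_map a b c d x \<and> affine_map a b c d x < d"
  using affine_map_strict_mono[OF assms(1,2), of a x] affine_map_strict_mono[OF assms(1,2), of x b] assms
  by (cases "x = a") (auto simp: affine_map_left affine_map_right)

definition block :: "nat \<Rightarrow> tree \<Rightarrow> real list" where
  "block k t = map (affine_map 0 1 (lo k) (lo (k + 1))) (leaf_ends t)"

text \<open>Ordered version of \<open>blocks\<close>: crossings refer to the ranks of strands, so
  the positions are needed as an increasing list.\<close>

fun block_list :: "nat \<Rightarrow> tree list \<Rightarrow> real list" where
  "block_list k [] = []"
| "block_list k (t # ts) = block k t @ block_list (Suc k) ts"

lemma length_block [simp]: "length (block k t) = leaf_count t"
  by (simp add: block_def)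

lemma length_block_list [simp]: "length (block_list k ts) = leaf_total ts"
  by (induction ts arbitrary: k) auto

lemma set_block: "1 \<le> k \<Longrightarrow> set (block k t) \<subseteq> I k"
  using affine_block_subset[of k t] by (simp add: block_def)

lemma set_block_list: "set (block_list k ts) = blocks k ts"
  by (induction ts arbitrary: k) (auto simp: block_def)

lemma block_list_append: "block_list k (us @ vs) = block_list k us @ block_list (k + length us) vs"
  by (induction us arbitrary: k) auto

lemma sorted_wrt_block: "1 \<le> k \<Longrightarrow> sorted_wrt (<) (block k t)"
  unfolding block_def sorted_wrt_map
  by (rule sorted_wrt_mono_rel[OF _ sorted_wrt_leaf_ends]) (use lo_less in \<open>auto intro!: affine_map_strict_mono\<close>)

lemma block_list_less:
  assumes "1 \<le> k" "x \<in> set (block_list k us)"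
  shows "x < lo (k + length us)"
proof -
  obtain l where "k \<le> l" "l < k + length us" "x \<in> I l"
    using blocks_index[of k x us] assms by (auto simp: set_block_list)
  then show ?thesis
    using lo_mono[of "l + 1" "k + length us"] assms(1) by (auto simp: I_def)
qed

lemma block_list_ge:
  assumes "1 \<le> k" "x \<in> set (block_list k us)"
  shows "lo k \<le> x"
proof -
  obtain l where "k \<le> l" "l < k + length us" "x \<in> I l"
    using blocks_index[of k x us] assms by (auto simp: set_block_list)
  then show ?thesis
    using lo_mono[of k l] assms(1) by (auto simp: I_def)
qed

lemma sorted_wrt_block_list: "1 \<le> k \<Longrightarrow> sorted_wrt (<) (block_list k ts)"
proof (induction ts arbitrary: k)
  case (Cons t ts)
  have "x < y" if "x \<in> set (block k t)" "y \<in> set (block_list (Suc k) ts)" for x y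
    using set_block[of k t] block_list_ge[of "Suc k" y ts] that Cons.prems by (auto simp: I_def)
  then show ?case
    using Cons.IH[of "Suc k"] Cons.prems sorted_wrt_block[of k t] by (auto simp: sorted_wrt_append)
qed simp

lemma positions_eq_block_list: "positions t = set (block_list 1 (dec t))"
  by (simp add: positions_eq_blocks set_block_list)

lemma sorted_list_of_positions: "sorted_list_of_set (positions t) = block_list 1 (dec t)"
  using sorted_wrt_block_list[of 1 "dec t"]
  by (simp add: positions_eq_block_list strict_sorted_iff sorted_list_of_set.idem_if_sorted_distinct)

text \<open>No correction by one is due: the rightmost leaf, which has no position, is the end of
  the comb and belongs to no entry of \<open>dec t\<close>.\<close>

lemma card_positions: "card (positions t) = leaf_total (dec t)"
  using sorted_wrt_block_list[of 1 "dec t"]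
  by (simp add: positions_eq_block_list strict_sorted_iff distinct_card)

lemma sorted_map_strict:
  assumes "sorted_wrt (<) xs" "\<And>x y. x \<in> set xs \<Longrightarrow> y \<in> set xs \<Longrightarrow> x < y \<Longrightarrow> f x < f y"
  shows "sorted (map f (xs :: real list))"
  unfolding sorted_map
  by (rule sorted_wrt_mono_rel[OF _ assms(1)]) (use assms(2) in \<open>auto intro: less_imp_le\<close>)

text \<open>Only two consecutive blocks of strands move, each increasingly, and they trade places;
  \<open>leaf_total us\<close> strands stand to their left.\<close>

lemma crossings_Sig:
  assumes "1 \<le> i" "length us = i - 1" "dec t = us @ [u, v] @ vs"
  shows "crossings (gen_diagram t (Sig i)) = cable (1 + leaf_total us) (leaf_count u) (leaf_count v)"
proof -
  let ?f = "sig_move i" and ?A = "block_list 1 us" and ?B = "block i u" and ?C = "block (i + 1) v"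
    and ?D = "block_list (i + 2) vs"
  have positions: "block_list 1 (dec t) = ?A @ ?B @ ?C @ ?D"
    using assms by (simp add: block_list_append)
  have lo: "lo i < lo (i + 1)" "lo (i + 1) < lo (i + 2)"
    using lo_less[of i] lo_less[of "i + 1"] assms(1) by simp_all
  have "x < lo i" if "x \<in> set ?A" for x
    using block_list_less[OF _ that] assms by simp
  then have A: "x < lo i \<and> ?f x = x" if "x \<in> set ?A" for x
    using that lo by (fastforce simp: sig_move_def I_def)
  have "lo (i + 2) \<le> x" if "x \<in> set ?D" for x
    using block_list_ge[OF _ that] by simp
  then have D: "lo (i + 2) \<le> x \<and> ?f x = x" if "x \<in> set ?D" for x
    using that lo by (fastforce simp: sig_move_def I_def)
  have B_eq: "x \<in> I i \<and> ?f x = affine_I i (i + 1) x" if "x \<in> set ?B" for x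
    using that set_block[of i u] assms(1) by (auto simp: sig_move_def)
  have B: "lo (i + 1) \<le> ?f x \<and> ?f x < lo (i + 2)" if "x \<in> set ?B" for x
    using B_eq[OF that] affine_map_bounds[OF lo] by (simp add: affine_I_def I_def)
  have C_eq: "x \<in> I (i + 1) \<and> ?f x = affine_I (i + 1) i x" if "x \<in> set ?C" for x
    using that set_block[of "i + 1" v] by (auto simp: sig_move_def I_def)
  have C: "lo i \<le> ?f x \<and> ?f x < lo (i + 1)" if "x \<in> set ?C" for x
    using C_eq[OF that] affine_map_bounds[OF lo(2,1)] by (simp add: affine_I_def I_def)
  have sortedA: "sorted (map ?f ?A)"
    by (rule sorted_map_strict[OF sorted_wrt_block_list]) (use A in auto)
  have sortedB: "sorted (map ?f ?B)"
    by (rule sorted_map_strict[OF sorted_wrt_block])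
      (use B_eq assms(1) affine_map_strict_mono[OF lo] in \<open>auto simp: affine_I_def\<close>)
  have sortedC: "sorted (map ?f ?C)"
    by (rule sorted_map_strict[OF sorted_wrt_block])
      (use C_eq affine_map_strict_mono[OF lo(2,1)] in \<open>auto simp: affine_I_def\<close>)
  have sortedD: "sorted (map ?f ?D)"
    by (rule sorted_map_strict[OF sorted_wrt_block_list]) (use D in auto)
  have sortedCD: "sorted (map ?f (?C @ ?D))"
    using sortedC sortedD C D lo by (force simp: sorted_append)
  have "direct_crossings ?f (\<lambda>x y. x \<in> I i) 1 (?A @ ?B @ ?C @ ?D)
      = direct_crossings ?f (\<lambda>x y. x \<in> I i) (1 + leaf_total us) (?B @ ?C @ ?D)"
    using direct_crossings_sorted_append[OF sortedA, of "?B @ ?C @ ?D"] A B C D lo by fastforce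
  also have "\<dots> = cable (1 + leaf_total us) (length ?B) (length ?C)"
    by (rule direct_crossings_swap[OF sortedB sortedCD]) (use B C D B_eq lo in fastforce)+
  finally show ?thesis
    using positions by (simp add: connect_def sorted_list_of_positions)
qed

text \<open>The images of the intervals \<open>I k\<close> under \<open>a_move i\<close> are consecutive, from \<open>a_lo i k\<close> to
  \<open>a_lo i (k + 1)\<close>.\<close>

definition a_lo :: "nat \<Rightarrow> nat \<Rightarrow> real" where
  "a_lo i k = (if k \<le> i then lo k else if k = i + 1 then (lo i + lo (i + 1)) / 2 else lo (k - 1))"

lemma a_lo_less: "1 \<le> i \<Longrightarrow> 1 \<le> k \<Longrightarrow> a_lo i k < a_lo i (k + 1)"
proof -
  assume i: "1 \<le> i" "1 \<le> k"
  consider "k < i" | "k = i" | "k = i + 1" | "i + 2 \<le> k" by linarith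
  then show ?thesis
    using lo_less[of k] lo_less[of i] lo_less[of "k - 1"] i by cases (auto simp: a_lo_def field_simps)
qed

lemma a_lo_mono:
  assumes "1 \<le> i" "1 \<le> k" "k \<le> l"
  shows "a_lo i k \<le> a_lo i l"
  using assms(3)
proof (induction l rule: dec_induct)
  case (step n)
  then show ?case using a_lo_less[of i n] assms(1,2) by simp
qed simp

lemma a_move_affine:
  assumes "1 \<le> i" "1 \<le> k" "x \<in> I k"
  shows "a_move i x = affine_map (lo k) (lo (k + 1)) (a_lo i k) (a_lo i (k + 1)) x"
proof -
  consider "k < i" | "k = i" | "k = i + 1" | "i + 2 \<le> k" by linarith
  then show ?thesis
    using lo_less[of k] assms interval_index_eq[of k x]
    by cases (auto simp: a_move_def a_lo_def affine_I_def affine_map_def Let_def)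
qed

text \<open>Inside one interval the map is affine and increasing; for different intervals a value of
  \<open>a_lo\<close> separates the images.\<close>

lemma a_move_strict_mono:
  assumes "1 \<le> i" "1 \<le> k" "x \<in> I k" "1 \<le> l" "y \<in> I l" "x < y"
  shows "a_move i x < a_move i y"
proof (cases "k = l")
  case True
  then show ?thesis
    using assms a_move_affine affine_map_strict_mono[OF lo_less[of k] a_lo_less[of i k]] by simp
next
  case False
  have "\<not> l < k"
    using lo_mono[of "l + 1" k] assms by (auto simp: I_def)
  then have "a_lo i (k + 1) \<le> a_lo i l"
    using False a_lo_mono[of i "k + 1" l] assms by simp
  then show ?thesis
    using affine_map_bounds[OF lo_less[of k] a_lo_less[of i k], of x]
      affine_map_bounds[OF lo_less[of l] a_lo_less[of i l], of y] assms a_move_affine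
    by (auto simp: I_def)
qed

lemma crossings_Gen_a:
  assumes "1 \<le> i"
  shows "crossings (gen_diagram t (Gen_a i)) = []"
proof -
  have "sorted (map (a_move i) (block_list 1 (dec t)))"
  proof (rule sorted_map_strict[OF sorted_wrt_block_list])
    fix x y assume xy: "x \<in> set (block_list 1 (dec t))" "y \<in> set (block_list 1 (dec t))" "x < y"
    obtain k l where "1 \<le> k" "x \<in> I k" "1 \<le> l" "y \<in> I l"
      using blocks_index[of 1 x "dec t"] blocks_index[of 1 y "dec t"] xy
      by (auto simp: set_block_list)
    then show "a_move i x < a_move i y"
      using a_move_strict_mono assms xy by blast
  qed simp
  then show ?thesis
    by (simp add: connect_def sorted_list_of_positions direct_crossings_sorted)
qed

section \<open>Isotopic diagrams come from equivalent words\<close>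

lemma grow_all_gen_act:
  assumes "gen_act t x = Some t'"
  shows "grow_all 1 (dec t) @ [(x, True)] \<simeq> braid_word (crossings (gen_diagram t x)) @ grow_all 1 (dec t')"
proof (cases x)
  case (Sig i)
  obtain us u v vs where "1 \<le> i" "length us = i - 1" "dec t = us @ [u, v] @ vs" "dec t' = us @ [v, u] @ vs"
    using assms unfolding Sig by (rule gen_act_SigE)
  then show ?thesis
    using grow_all_sig_act[of i us u v vs] crossings_Sig[of i us t u v vs] Sig by metis
next
  case (Gen_a i)
  obtain us u v vs where "1 \<le> i" "length us = i - 1" "dec t = us @ [u, v] @ vs" "dec t' = us @ [Node u v] @ vs"
    using assms unfolding Gen_a by (rule gen_act_aE)
  then show ?thesis
    using grow_all_a_act[of i us u v vs] crossings_Gen_a[of i t] Gen_a by simp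
qed

lemma braid_word_mirror: "braid_word (crossings (mirror d)) = word_inv (braid_word (crossings d))"
  by (simp add: mirror_def braid_word_def word_inv_def rev_map comp_def case_prod_beta)

lemma letter_act_False_iff: "letter_act t (x, False) = Some t' \<longleftrightarrow> gen_act t' x = Some t"
  using letter_act_inverse[of t x True t'] by simp

lemma grow_all_letter_act:
  assumes "letter_act t x = Some t'"
  shows "grow_all 1 (dec t) @ [x] \<simeq> braid_word (crossings (letter_diagram t x)) @ grow_all 1 (dec t')"
proof (cases x)
  case (Pair g b)
  show ?thesis
  proof (cases b)
    case True
    then show ?thesis using grow_all_gen_act assms Pair by simp
  next
    case False
    then have "gen_act t' g = Some t" using assms Pair by (simp add: letter_act_False_iff del: letter_act.simps)
    \<comment> \<open>The identity for the positive letter leads from \<open>t'\<close> back to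
      \<open>t\<close>. Flipping it inverts both the letter and the braid, and the mirror image
      reads as the inverse braid.\<close>
    then show ?thesis
      using paren.equivalent_flip[OF paren.equivalent_sym[OF grow_all_gen_act]] assms Pair False
      by (simp add: braid_word_mirror del: letter_act.simps)
  qed
qed

lemma grow_all_word_act:
  assumes "word_act t w = Some t'"
  shows "grow_all 1 (dec t) @ w \<simeq> braid_word (crossings (word_diagram t w)) @ grow_all 1 (dec t')"
  using assms
proof (induction w arbitrary: t)
  case (Cons x w)
  obtain s where s: "letter_act t x = Some s" "word_act s w = Some t'"
    using Cons.prems by (auto simp: bind_eq_Some_conv)
  have w: "w \<in> words_over gens" "braid_word (crossings (letter_diagram t x)) \<in> words_over gens"
    using paren.equivalent_words[OF Cons.IH[OF s(2)]]
      paren.equivalent_words[OF grow_all_letter_act[OF s(1)]] by auto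
  have "(grow_all 1 (dec t) @ [x]) @ w
      \<simeq> braid_word (crossings (letter_diagram t x)) @ grow_all 1 (dec s) @ w"
    using paren.equivalent_context[OF grow_all_letter_act[OF s(1)], of "[]" w] w by simp
  also have "\<dots> \<simeq> braid_word (crossings (letter_diagram t x)) @
      braid_word (crossings (word_diagram s w)) @ grow_all 1 (dec t')"
    using paren.equivalent_context[OF Cons.IH[OF s(2)], of _ "[]"] w by simp
  finally show ?case using s by (simp add: stack_def)
qed simp

lemma isotopic_equivalent:
  assumes "word_act t w \<noteq> None" "word_act t w' \<noteq> None"
    and iso: "isotopic (word_diagram t w) (word_diagram t w')"
  shows "w \<simeq> w'"
proof -
  obtain s s' where s: "word_act t w = Some s" "word_act t w' = Some s'"
    using assms(1,2) by auto
  \<comment> \<open>Isotopy fixes the endpoints, and the bottom line determines the final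
    tree.\<close>
  have "positions s = positions s'"
    using isotopic_braid_word[OF iso] bottom_word_diagram s by metis
  then have [simp]: "s' = s" using positions_inj by metis
  note grow = grow_all_word_act[OF s(1)] grow_all_word_act[OF s(2)]
  \<comment> \<open>Equivalence holds only between words over \<open>gens\<close>; this supplies the
    condition under which \<open>isotopic_braid_word\<close> gives an equivalence.\<close>
  have words: "w \<in> words_over gens" "w' \<in> words_over gens"
    "braid_word (crossings (word_diagram t w)) \<in> words_over gens"
    using paren.equivalent_words[OF grow(1)] paren.equivalent_words[OF grow(2)] by auto
  have "grow_all 1 (dec t) @ w \<simeq> braid_word (crossings (word_diagram t w)) @ grow_all 1 (dec s)"
    by (rule grow)
  also have "\<dots> \<simeq> braid_word (crossings (word_diagram t w')) @ grow_all 1 (dec s)"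
    using paren.equivalent_context[of _ _ "[]" "grow_all 1 (dec s)"] isotopic_braid_word[OF iso] words by simp
  also have "\<dots> \<simeq> grow_all 1 (dec t) @ w'"
    using grow(2) by (simp add: paren.equivalent_sym)
  finally have "w \<simeq> word_inv (grow_all 1 (dec t)) @ grow_all 1 (dec t) @ w'"
    using paren.equivalent_flip[of "grow_all 1 (dec t)" w "grow_all 1 (dec t) @ w'" "[]"] by simp
  also have "\<dots> \<simeq> w'"
    using paren.equivalent_context[OF paren.equivalent_inv_left, of "grow_all 1 (dec t)" "[]" w'] words by simp
  finally show ?thesis .
qed

section \<open>Cables of strands\<close>

text \<open>Isotopy depends on the endpoints only through the number of strands, which enters in the
  condition of \<open>R2\<close>. Quantifying over \<open>X\<close> and \<open>Y\<close> lets
  crossings be treated as words that can be put into any context.\<close>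

definition braid_equivalent :: "nat \<Rightarrow> crossing list \<Rightarrow> crossing list \<Rightarrow> bool" where
  "braid_equivalent n u v \<longleftrightarrow> (\<forall>X Y. card X = n \<longrightarrow> isotopic (Diagram X u Y) (Diagram X v Y))"

lemma isotopic_context:
  assumes "isotopic d e" "card X = card (top_pos d)"
  shows "isotopic (Diagram X (p @ crossings d @ q) Y) (Diagram X (p @ crossings e @ q) Y)"
  using assms
proof (induction rule: isotopic.induct)
  case (planar k l X' u a b v Y')
  then show ?case using isotopic.planar[of k l X "p @ u" a b "v @ q" Y] by simp
next
  case (R2 k X' u a v Y')
  then show ?case using isotopic.R2[of k X "p @ u" a "v @ q" Y] by simp
next
  case (R3 a c b X' u k v Y')
  then show ?case using isotopic.R3[of a c b X "p @ u" k "v @ q" Y] by simp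
next
  case (sym d e)
  \<comment> \<open>Isotopic diagrams have equal top lines, so the assumption on
    \<open>card X\<close> passes to the other diagram.\<close>
  then show ?case using isotopic_braid_word by (metis isotopic.sym)
next
  case (trans d e f)
  then show ?case using isotopic_braid_word by (metis isotopic.trans)
qed (simp add: isotopic.refl)

lemma braid_equivalent_refl [simp]: "braid_equivalent n u u"
  by (simp add: braid_equivalent_def isotopic.refl)

lemma braid_equivalent_sym: "braid_equivalent n u v \<Longrightarrow> braid_equivalent n v u"
  by (simp add: braid_equivalent_def isotopic.sym)

lemma braid_equivalent_trans [trans]:
  "braid_equivalent n u v \<Longrightarrow> braid_equivalent n v w \<Longrightarrow> braid_equivalent n u w"
  unfolding braid_equivalent_def by (blast intro: isotopic.trans)

lemma braid_equivalent_context: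
  assumes "braid_equivalent n u v"
  shows "braid_equivalent n (p @ u @ q) (p @ v @ q)"
  unfolding braid_equivalent_def
proof (intro allI impI)
  fix X :: "real set" and Y assume "card X = n"
  then show "isotopic (Diagram X (p @ u @ q) Y) (Diagram X (p @ v @ q) Y)"
    using isotopic_context[of "Diagram X u Y" "Diagram X v Y" X p q Y] assms
    by (simp add: braid_equivalent_def)
qed

lemma braid_equivalent_slide:
  assumes "list_all2 (\<lambda>x y. braid_equivalent n ([x] @ g) (g @ [y])) u v"
  shows "braid_equivalent n (u @ g) (g @ v)"
  using assms
proof (induction rule: list_all2_induct)
  case (Cons x xs y ys)
  have "braid_equivalent n ([x] @ xs @ g) ([x] @ g @ ys)"
    using braid_equivalent_context[OF Cons.IH, of "[x]" "[]"] by simp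
  also have "braid_equivalent n ([x] @ g @ ys) (g @ y # ys)"
    using braid_equivalent_context[OF Cons.hyps(1), of "[]" ys] by simp
  finally show ?case by simp
qed simp

lemma braid_equivalent_commute:
  assumes "\<forall>(k, a)\<in>set u. \<forall>(l, b)\<in>set v. k + 2 \<le> l \<or> l + 2 \<le> k"
  shows "braid_equivalent n (u @ v) (v @ u)"
proof (rule braid_equivalent_slide)
  have pair: "braid_equivalent n [(k, a), (l, b)] [(l, b), (k, a)]" if "k + 2 \<le> l \<or> l + 2 \<le> k" for k a l b
    using isotopic.planar[OF that, of _ "[]" _ _ "[]"] by (simp add: braid_equivalent_def)
  have "braid_equivalent n ([x] @ v) (v @ [x])" if "x \<in> set u" for x
  proof (rule braid_equivalent_sym, rule braid_equivalent_slide)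
    show "list_all2 (\<lambda>y z. braid_equivalent n ([y] @ [x]) ([x] @ [z])) v v"
      using assms that pair by (fastforce simp: list_all2_same)
  qed
  then show "list_all2 (\<lambda>x y. braid_equivalent n ([x] @ v) (v @ [y])) u u"
    by (simp add: list_all2_same)
qed

section \<open>Sliding crossings and cables under a cable\<close>

lemma set_strand_pass: "(l, b) \<in> set (strand_pass k q) \<Longrightarrow> k \<le> l \<and> l < k + q \<and> b"
  by (auto simp: strand_pass_def)

text \<open>A crossing of two under-strands slides below the passing strand by one move
  \<open>R3\<close>. Its index drops by one because that strand has moved from their left to their
  right.\<close>

lemma strand_pass_slide:
  assumes "k \<le> j" "j + 2 \<le> k + q"
  shows "braid_equivalent n ((j + 1, True) # strand_pass k q) (strand_pass k q @ [(j, True)])"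
proof -
  \<comment> \<open>The pass is cut around its two crossings that meet the sliding one; the
    \<open>d\<close> crossings before them and the \<open>e\<close> crossings after them commute
    with it.\<close>
  define d e where "d = j - k" and "e = k + q - (j + 2)"
  let ?l = "strand_pass k d" and ?r = "strand_pass (j + 2) e"
  have "q = d + Suc (Suc e)" "k + d = j" using assms by (auto simp: d_def e_def)
  then have q: "strand_pass k q = ?l @ [(j, True), (j + 1, True)] @ ?r"
    using strand_pass_add[of k d "Suc (Suc e)"] by (simp add: strand_pass_Suc)
  have "braid_equivalent n ([(j + 1, True)] @ ?l) (?l @ [(j + 1, True)])"
    by (rule braid_equivalent_commute) (auto dest!: set_strand_pass simp: d_def)
  then have "braid_equivalent n ((j + 1, True) # strand_pass k q)
      (?l @ [(j + 1, True), (j, True), (j + 1, True)] @ ?r)"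
    using braid_equivalent_context[of n _ _ "[]" "[(j, True), (j + 1, True)] @ ?r"] q by fastforce
  also have "braid_equivalent n (?l @ [(j + 1, True), (j, True), (j + 1, True)] @ ?r)
      (?l @ [(j, True), (j + 1, True), (j, True)] @ ?r)"
    by (rule braid_equivalent_context, rule braid_equivalent_sym)
      (use isotopic.R3[of True True True _ "[]" j "[]"] in \<open>simp add: braid_equivalent_def\<close>)
  also have "braid_equivalent n (?l @ [(j, True), (j + 1, True), (j, True)] @ ?r)
      (strand_pass k q @ [(j, True)])"
  proof -
    have "braid_equivalent n ([(j, True)] @ ?r) (?r @ [(j, True)])"
      by (rule braid_equivalent_commute) (auto dest!: set_strand_pass)
    then show ?thesis
      using braid_equivalent_context[of n _ _ "?l @ [(j, True), (j + 1, True)]" "[]"] q by fastforce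
  qed
  finally show ?thesis .
qed

lemma cable_slide_crossing:
  "k \<le> j \<Longrightarrow> j + 2 \<le> k + q \<Longrightarrow>
   braid_equivalent n ((j + p, True) # cable k p q) (cable k p q @ [(j, True)])"
proof (induction p arbitrary: k j)
  case (Suc p)
  have "braid_equivalent n ((j + Suc p, True) # cable (Suc k) p q @ strand_pass k q)
      (cable (Suc k) p q @ [(j + 1, True)] @ strand_pass k q)"
    using braid_equivalent_context[OF Suc.IH[of "Suc k" "j + 1"], of "[]" "strand_pass k q"] Suc.prems by simp
  also have "braid_equivalent n (cable (Suc k) p q @ [(j + 1, True)] @ strand_pass k q)
      (cable (Suc k) p q @ strand_pass k q @ [(j, True)])"
    using braid_equivalent_context[OF strand_pass_slide[of k j q n], of "cable (Suc k) p q" "[]"] Suc.prems by simp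
  finally show ?case by simp
qed simp

lemma cable_slide_cable:
  "braid_equivalent n (cable (k + p) q r @ cable k p (q + r)) (cable k p (q + r) @ cable k q r)"
proof (rule braid_equivalent_slide, rule list.rel_mono_strong[OF cable_shift])
  fix x y :: crossing
  assume "(case x of (i, b) \<Rightarrow> \<lambda>(j, c). i = j + p \<and> b = c \<and> k \<le> j) y" "y \<in> set (cable k q r)"
  then obtain j where "y = (j, True)" "x = (j + p, True)" "k \<le> j" "j + 2 \<le> k + (q + r)"
    using set_cable[of _ _ k q r] by (cases x; cases y) fastforce
  then show "braid_equivalent n ([x] @ cable k p (q + r)) (cable k p (q + r) @ [y])"
    using cable_slide_crossing by simp
qed

text \<open>The leftmost over-strand crosses the first group while the other over-strands cross the
  second. These crossings share no strand, so their order can be exchanged.\<close>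

lemma cable_add_right:
  "braid_equivalent n (cable k p q @ cable (k + q) p r) (cable k p (q + r))"
proof (induction p arbitrary: k)
  case (Suc p)
  have "braid_equivalent n (strand_pass k q @ cable (Suc k + q) p r) (cable (Suc k + q) p r @ strand_pass k q)"
    by (rule braid_equivalent_commute) (auto dest!: set_strand_pass set_cable)
  then have "braid_equivalent n (cable k (Suc p) q @ cable (k + q) (Suc p) r)
      ((cable (Suc k) p q @ cable (Suc k + q) p r) @ strand_pass k q @ strand_pass (k + q) r)"
    using braid_equivalent_context[of n _ _ "cable (Suc k) p q" "strand_pass (k + q) r"] by fastforce
  also have "braid_equivalent n \<dots> (cable (Suc k) p (q + r) @ strand_pass k q @ strand_pass (k + q) r)"
    using braid_equivalent_context[OF Suc.IH[of "Suc k"], of "[]"] by simp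
  finally show ?case by (simp add: strand_pass_add)
qed simp

text \<open>The two lower groups together form one group of \<open>q + r\<close> strands; their
  mutual crossing slides below the upper cable as a whole.\<close>

lemma cable_braid:
  "braid_equivalent n (cable k p q @ cable (k + q) p r @ cable k q r)
     (cable (k + p) q r @ cable k p r @ cable (k + r) p q)"
proof -
  have "braid_equivalent n ((cable k p q @ cable (k + q) p r) @ cable k q r) (cable k p (q + r) @ cable k q r)"
    using braid_equivalent_context[OF cable_add_right[of n k p q r], of "[]"] by simp
  \<comment> \<open>The lower groups have now changed places, so the sum is split next as
    \<open>r + q\<close>.\<close>
  also have "braid_equivalent n \<dots> (cable (k + p) q r @ cable k p (r + q))"
    using braid_equivalent_sym[OF cable_slide_cable] by (simp add: add.commute)
  also have "braid_equivalent n \<dots> (cable (k + p) q r @ cable k p r @ cable (k + r) p q)"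
    using braid_equivalent_context[OF braid_equivalent_sym[OF cable_add_right[of n k p r q]], of _ "[]"] by simp
  finally show ?thesis by simp
qed

text \<open>Cancellation from the innermost pair outwards; the bounds on the indices are the side
  conditions of \<open>R2\<close>.\<close>

lemma braid_equivalent_mirror:
  assumes "\<forall>(k, b)\<in>set cs. 1 \<le> k \<and> k < n"
  shows "braid_equivalent n (cs @ map (\<lambda>(k, b). (k, \<not> b)) (rev cs)) []"
  using assms
proof (induction cs)
  case (Cons c cs)
  obtain k b where c: "c = (k, b)" by force
  have "braid_equivalent n ([c] @ (cs @ map (\<lambda>(k, b). (k, \<not> b)) (rev cs)) @ [(k, \<not> b)]) ([c] @ [] @ [(k, \<not> b)])"
    by (rule braid_equivalent_context) (use Cons in auto)
  also have "braid_equivalent n ([c] @ [] @ [(k, \<not> b)]) []"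
    using isotopic.R2[of k _ "[]" b "[]"] Cons.prems c by (simp add: braid_equivalent_def)
  finally show ?case by (simp add: c)
qed simp

section \<open>The relations hold for diagrams\<close>

text \<open>With the tree given by a split list and the index as \<open>Suc (length us)\<close>,
  simplification can follow a whole word acting on that tree.\<close>

lemma gen_act_tree_of_Sig:
  "gen_act (tree_of (us @ u # v # vs)) (Sig (Suc (length us))) = Some (tree_of (us @ v # u # vs))"
  and gen_act_tree_of_Gen_a:
  "gen_act (tree_of (us @ u # v # vs)) (Gen_a (Suc (length us))) = Some (tree_of (us @ Node u v # vs))"
  by (simp_all add: gen_act.simps nth_append)

declare gen_act.simps [simp del] gen_diagram.simps [simp del] letter_act.simps(2) [simp del]

lemma crossings_tree_of_Sig:
  "crossings (gen_diagram (tree_of (us @ u # v # vs)) (Sig (Suc (length us))))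
    = cable (Suc (leaf_total us)) (leaf_count u) (leaf_count v)"
  using crossings_Sig[of "Suc (length us)" us "tree_of (us @ u # v # vs)" u v vs] by simp

lemma crossings_Gen_a_Suc: "crossings (gen_diagram t (Gen_a (Suc i))) = []"
  using crossings_Gen_a[of "Suc i" t] by simp

lemma crossings_stack [simp]: "crossings (stack d e) = crossings d @ crossings e"
  by (simp add: stack_def)

lemma length_gen_act:
  "gen_act t (Sig i) = Some t' \<Longrightarrow> i < length (dec t) \<and> length (dec t') = length (dec t)"
  "gen_act t (Gen_a i) = Some t' \<Longrightarrow> i < length (dec t) \<and> length (dec t) = Suc (length (dec t'))"
  by (auto elim!: gen_act_SigE gen_act_aE)

lemma split_list_nth: "i < length ts \<Longrightarrow> \<exists>us u vs. ts = us @ u # vs \<and> length us = i"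
  by (metis id_take_nth_drop length_take min.absorb4)

lemma dec_split3:
  assumes "1 \<le> i" "i + 1 < length (dec t)"
  obtains us x y z vs where "t = tree_of (us @ x # y # z # vs)" "i = Suc (length us)"
proof -
  have "i - 1 < length (dec t)" using assms by simp
  then obtain us x vs where 1: "dec t = us @ x # vs" "length us = i - 1"
    using split_list_nth by blast
  moreover obtain y z ws where "vs = y # z # ws"
    using 1 assms by (cases vs; cases "tl vs") auto
  ultimately show ?thesis
    using that[of us x y z ws] assms(1) tree_of_dec[of t] by auto
qed

lemma dec_split22:
  assumes "1 \<le> i" "i + 2 \<le> j" "j < length (dec t)"
  obtains us u v ms x y vs where "t = tree_of (us @ u # v # ms @ x # y # vs)"
    "i = Suc (length us)" "j = Suc (length us + 2 + length ms)"
proof -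
  have "i - 1 < length (dec t)" using assms by simp
  then obtain us u ws where 1: "dec t = us @ u # ws" "length us = i - 1"
    using split_list_nth by blast
  obtain v ws' where 2: "ws = v # ws'"
    using 1 assms by (cases ws) auto
  have "j - i - 2 < length ws'" using 1 2 assms by simp
  then obtain ms x zs where 3: "ws' = ms @ x # zs" "length ms = j - i - 2"
    using split_list_nth by blast
  obtain y vs where "zs = y # vs"
    using 1 2 3 assms by (cases zs) auto
  then show ?thesis
    using that[of us u v ms x y vs] 1 2 3 assms tree_of_dec[of t] by auto
qed

text \<open>All relations follow from exchanges of heights and \<open>R3\<close>, so they hold for
  any number \<open>n\<close> of strands.\<close>

lemma relation_sound:
  assumes "(l, r) \<in> paren_braid_relations" "word_act t l \<noteq> None"
  shows "word_act t r = word_act t l \<and>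
    braid_equivalent n (crossings (word_diagram t l)) (crossings (word_diagram t r))"
proof -
  note steps = gen_act_tree_of_Sig gen_act_tree_of_Gen_a crossings_tree_of_Sig
  note step1 = steps crossings_Gen_a_Suc
  consider
    (far) i j where "1 \<le> i" "i + 2 \<le> j"
      "(l, r) \<in> {([\<sigma> i, \<sigma> j], [\<sigma> j, \<sigma> i]), ([\<sigma> i, \<a> j], [\<a> j, \<sigma> i]),
         ([\<a> i, \<a> (j - 1)], [\<a> j, \<a> i]), ([\<a> i, \<sigma> (j - 1)], [\<sigma> j, \<a> i])}"
  | (near) i where "1 \<le> i"
      "(l, r) \<in> {([\<sigma> i, \<sigma> (i + 1), \<sigma> i], [\<sigma> (i + 1), \<sigma> i, \<sigma> (i + 1)]),
         ([\<sigma> (i + 1), \<sigma> i, \<a> (i + 1)], [\<a> i, \<sigma> i]), ([\<sigma> i, \<sigma> (i + 1), \<a> i], [\<a> (i + 1), \<sigma> i])}"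
    using assms(1) unfolding paren_braid_relations_def by blast
  then show ?thesis
  proof cases
    case far
    have "j < length (dec t)"
      using far assms(2) by (auto simp: bind_eq_Some_conv dest!: length_gen_act)
    then obtain us u v ms x y vs where t: "t = tree_of (us @ u # v # ms @ x # y # vs)"
      "i = Suc (length us)" "j = Suc (length us + 2 + length ms)"
      using dec_split22 far(1,2) by metis
    \<comment> \<open>The second letter acts behind a longer prefix, with two entries or their
      merged node in front; the rules are instantiated at these shapes.\<close>
    note step2 = steps[of "us @ u # w # ms" for us u w ms, simplified]
      steps[of "us @ w # ms" for us w ms, simplified]
    have comm: "braid_equivalent n
       (cable (Suc (leaf_total us)) (leaf_count u) (leaf_count v) @
        cable (Suc (leaf_total us + (leaf_count u + (leaf_count v + leaf_total ms)))) (leaf_count x) (leaf_count y))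
       (cable (Suc (leaf_total us + (leaf_count u + (leaf_count v + leaf_total ms)))) (leaf_count x) (leaf_count y) @
        cable (Suc (leaf_total us)) (leaf_count u) (leaf_count v))"
      by (rule braid_equivalent_commute) (auto dest!: set_cable)
    show ?thesis
      using far(3) comm by (auto simp: t step1 step2 add.assoc add.left_commute)
  next
    case near
    have "i + 1 < length (dec t)"
      using near assms(2) by (auto simp: bind_eq_Some_conv dest!: length_gen_act)
    then obtain us x y z vs where t: "t = tree_of (us @ x # y # z # vs)" "i = Suc (length us)"
      using dec_split3 near(1) by metis
    note step2 = steps[of "us @ [w]" for us w, simplified]
    \<comment> \<open>Of the three relations, the braid relation is \<open>cable_braid\<close>,
      splitting the upper strand is \<open>cable_add\<close>, and splitting the lower strand is
      \<open>cable_add_right\<close>.\<close>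
    show ?thesis
      using near(2)
        cable_braid[of n "Suc (leaf_total us)" "leaf_count x" "leaf_count y" "leaf_count z"]
        cable_add_right[of n "Suc (leaf_total us)" "leaf_count x" "leaf_count y" "leaf_count z"]
      by (auto simp: t step1 step2 cable_add)
  qed
qed

lemma leaf_total_gen_act:
  assumes "gen_act t x = Some t'"
  shows "leaf_total (dec t') = leaf_total (dec t)"
  using assms by (cases x) (auto elim!: gen_act_SigE gen_act_aE)

lemma crossings_gen_diagram_bounds:
  assumes "gen_act t x = Some t'" "(k, b) \<in> set (crossings (gen_diagram t x))"
  shows "1 \<le> k \<and> k < leaf_total (dec t)"
proof (cases x)
  case (Sig i)
  obtain us u v vs where "1 \<le> i" "length us = i - 1" "dec t = us @ [u, v] @ vs"
    using assms(1) unfolding Sig by (rule gen_act_SigE)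
  then show ?thesis
    using set_cable[of k b "1 + leaf_total us" "leaf_count u" "leaf_count v"]
      crossings_Sig[of i us t u v vs] assms(2) Sig by auto
next
  case (Gen_a i)
  have "1 \<le> i" using assms(1) unfolding Gen_a by (rule gen_act_aE)
  then show ?thesis
    using assms(2) crossings_Gen_a[of i t] Gen_a by simp
qed

lemma cancel_sound:
  assumes "word_act t [(x, b), (x, \<not> b)] \<noteq> None"
  shows "word_act t [(x, b), (x, \<not> b)] = Some t \<and>
    braid_equivalent (leaf_total (dec t)) (crossings (word_diagram t [(x, b), (x, \<not> b)])) []"
proof -
  obtain s where s: "letter_act t (x, b) = Some s"
    using assms by (auto simp: bind_eq_Some_conv)
  then have s': "letter_act s (x, \<not> b) = Some t"
    using letter_act_inverse[of s x b t] by blast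
  show ?thesis
  proof (cases b)
    case True
    then have "gen_act t x = Some s" using s by simp
    then have "braid_equivalent (leaf_total (dec t))
        (crossings (gen_diagram t x) @ crossings (mirror (gen_diagram t x))) []"
      using crossings_gen_diagram_bounds unfolding mirror_def diagram.sel
      by (intro braid_equivalent_mirror) blast
    then show ?thesis using s s' True by simp
  next
    case False
    then have x: "gen_act s x = Some t" using s' by simp
    let ?c = "crossings (mirror (gen_diagram s x))"
    \<comment> \<open>Here the mirrored diagram comes first, and its own mirror image is the
      original one.\<close>
    have "map (\<lambda>(k, b). (k, \<not> b)) (rev ?c) = crossings (gen_diagram s x)"
      by (simp add: mirror_def rev_map comp_def case_prod_beta)
    moreover have "braid_equivalent (leaf_total (dec t)) (?c @ map (\<lambda>(k, b). (k, \<not> b)) (rev ?c)) []"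
      using crossings_gen_diagram_bounds[OF x] leaf_total_gen_act[OF x]
      by (intro braid_equivalent_mirror) (auto simp: mirror_def)
    ultimately show ?thesis using s s' False by simp
  qed
qed

section \<open>Large trees\<close>

fun included :: "tree \<Rightarrow> tree \<Rightarrow> bool" where
  "included Leaf t = True"
| "included (Node l r) Leaf = False"
| "included (Node l r) (Node l' r') = (included l l' \<and> included r r')"

text \<open>A larger tree may also grow at the end of the comb, hence the additional entries
  \<open>ss\<close>.\<close>

lemma included_iff_dec:
  "included t t' \<longleftrightarrow> (\<exists>ts ss. dec t' = ts @ ss \<and> list_all2 included (dec t) ts)"
proof (induction t arbitrary: t')
  case (Node l r)
  show ?case
    using Node.IH(2) by (cases t') (auto simp: list_all2_Cons1 Cons_eq_append_conv)
qed simp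

lemma included_gen_act:
  assumes "gen_act t x = Some s" "included t t'"
  shows "\<exists>s'. gen_act t' x = Some s' \<and> included s s'"
proof (cases x)
  case (Sig i)
  obtain us u v vs where i: "1 \<le> i" "length us = i - 1"
    and d: "dec t = us @ [u, v] @ vs" "dec s = us @ [v, u] @ vs"
    using assms(1) unfolding Sig by (rule gen_act_SigE)
  obtain us' u' v' vs' ss where t': "dec t' = us' @ u' # v' # vs' @ ss" "list_all2 included us us'"
    "included u u'" "included v v'" "list_all2 included vs vs'"
    using assms(2) d by (auto simp: included_iff_dec[of t] list_all2_append1 list_all2_Cons1)
  have "t' = tree_of (us' @ u' # v' # vs' @ ss)" "i = Suc (length us')"
    using t' i tree_of_dec[of t'] list_all2_lengthD[OF t'(2)] by auto
  moreover have "included s (tree_of (us' @ v' # u' # vs' @ ss))"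
    unfolding included_iff_dec[of s] using t' d
    by (intro exI[of _ "us' @ v' # u' # vs'"] exI[of _ ss]) (auto intro: list_all2_appendI)
  ultimately show ?thesis
    using gen_act_tree_of_Sig[of us' u' v' "vs' @ ss"] Sig by simp
next
  case (Gen_a i)
  obtain us u v vs where i: "1 \<le> i" "length us = i - 1"
    and d: "dec t = us @ [u, v] @ vs" "dec s = us @ [Node u v] @ vs"
    using assms(1) unfolding Gen_a by (rule gen_act_aE)
  obtain us' u' v' vs' ss where t': "dec t' = us' @ u' # v' # vs' @ ss" "list_all2 included us us'"
    "included u u'" "included v v'" "list_all2 included vs vs'"
    using assms(2) d by (auto simp: included_iff_dec[of t] list_all2_append1 list_all2_Cons1)
  have "t' = tree_of (us' @ u' # v' # vs' @ ss)" "i = Suc (length us')"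
    using t' i tree_of_dec[of t'] list_all2_lengthD[OF t'(2)] by auto
  moreover have "included s (tree_of (us' @ Node u' v' # vs' @ ss))"
    unfolding included_iff_dec[of s] using t' d
    by (intro exI[of _ "us' @ Node u' v' # vs'"] exI[of _ ss]) (auto intro: list_all2_appendI)
  ultimately show ?thesis
    using gen_act_tree_of_Gen_a[of us' u' v' "vs' @ ss"] Gen_a by simp
qed

lemma included_gen_act_inverse:
  assumes "gen_act s x = Some t" "included t t'"
  shows "\<exists>s'. gen_act s' x = Some t' \<and> included s s'"
proof (cases x)
  case (Sig i)
  obtain us u v vs where i: "1 \<le> i" "length us = i - 1"
    and d: "dec s = us @ [u, v] @ vs" "dec t = us @ [v, u] @ vs"
    using assms(1) unfolding Sig by (rule gen_act_SigE)
  obtain us' u' v' vs' ss where t': "dec t' = us' @ v' # u' # vs' @ ss" "list_all2 included us us'"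
    "included u u'" "included v v'" "list_all2 included vs vs'"
    using assms(2) d by (auto simp: included_iff_dec[of t] list_all2_append1 list_all2_Cons1)
  have "t' = tree_of (us' @ v' # u' # vs' @ ss)" "i = Suc (length us')"
    using t' i tree_of_dec[of t'] list_all2_lengthD[OF t'(2)] by auto
  moreover have "included s (tree_of (us' @ u' # v' # vs' @ ss))"
    unfolding included_iff_dec[of s] using t' d
    by (intro exI[of _ "us' @ u' # v' # vs'"] exI[of _ ss]) (auto intro: list_all2_appendI)
  ultimately show ?thesis
    using gen_act_tree_of_Sig[of us' u' v' "vs' @ ss"] Sig by blast
next
  case (Gen_a i)
  obtain us u v vs where i: "1 \<le> i" "length us = i - 1"
    and d: "dec s = us @ [u, v] @ vs" "dec t = us @ [Node u v] @ vs"
    using assms(1) unfolding Gen_a by (rule gen_act_aE)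
  obtain us' w' vs' ss where t': "dec t' = us' @ w' # vs' @ ss" "list_all2 included us us'"
    "included (Node u v) w'" "list_all2 included vs vs'"
    using assms(2) d by (auto simp: included_iff_dec[of t] list_all2_append1 list_all2_Cons1)
  \<comment> \<open>An entry that includes \<open>Node u v\<close> is itself a node, so the inverse
    letter can split it.\<close>
  obtain u' v' where w': "w' = Node u' v'" "included u u'" "included v v'"
    using t'(3) by (cases w') auto
  have "t' = tree_of (us' @ Node u' v' # vs' @ ss)" "i = Suc (length us')"
    using t' w' i tree_of_dec[of t'] list_all2_lengthD[OF t'(2)] by auto
  moreover have "included s (tree_of (us' @ u' # v' # vs' @ ss))"
    unfolding included_iff_dec[of s] using t' w' d
    by (intro exI[of _ "us' @ u' # v' # vs'"] exI[of _ ss]) (auto intro: list_all2_appendI)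
  ultimately show ?thesis
    using gen_act_tree_of_Gen_a[of us' u' v' "vs' @ ss"] Gen_a by blast
qed

lemma included_letter_act:
  assumes "letter_act t x = Some s" "included t t'"
  shows "\<exists>s'. letter_act t' x = Some s' \<and> included s s'"
proof (cases x)
  case (Pair g b)
  then show ?thesis
    using assms included_gen_act[of t g s t'] included_gen_act_inverse[of s g t t']
    by (cases b) (auto simp: letter_act_False_iff)
qed

lemma included_word_act:
  "word_act t w \<noteq> None \<Longrightarrow> included t t' \<Longrightarrow> word_act t' w \<noteq> None"
proof (induction w arbitrary: t t')
  case (Cons x w)
  obtain s where s: "letter_act t x = Some s" "word_act s w \<noteq> None"
    using Cons.prems(1) by (auto simp: bind_eq_Some_conv)
  obtain s' where "letter_act t' x = Some s'" "included s s'"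
    using included_letter_act[OF s(1) Cons.prems(2)] by blast
  then show ?case using Cons.IH[OF s(2)] by simp
qed simp

text \<open>A cofinal chain for inclusion: a single number measures how large a tree has to
  be.\<close>

fun full :: "nat \<Rightarrow> tree" where
  "full 0 = Leaf"
| "full (Suc n) = Node (full n) (full n)"

lemma included_full: "\<exists>N. \<forall>n\<ge>N. included t (full n)"
proof (induction t)
  case (Node l r)
  then obtain M N where "\<forall>n\<ge>M. included l (full n)" "\<forall>n\<ge>N. included r (full n)" by blast
  then have "included (Node l r) (full n)" if "n \<ge> Suc (M + N)" for n
    using that by (cases n) auto
  then show ?case by blast
qed simp

lemma letter_act_exists:
  assumes "fst x \<in> gens"
  shows "\<exists>t. letter_act t x \<noteq> None"
proof -
  obtain g b where x: "x = (g, b)" by force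
  have "\<exists>t t'. gen_act t g = Some t'"
    using assms x gen_act_tree_of_Sig[of "replicate i Leaf" Leaf Leaf "[]" for i]
      gen_act_tree_of_Gen_a[of "replicate i Leaf" Leaf Leaf "[]" for i]
    by (cases g) (auto simp: gr0_conv_Suc Suc_le_eq)
  then obtain t t' where "letter_act t (g, True) = Some t'" by auto
  then show ?thesis
    using x letter_act_inverse[of t' g True t] by (cases b) auto
qed

text \<open>To put a letter in front of a word, take a tree so large that both the word and the
  inverse letter act on it; the inverse letter then gives the starting tree.\<close>

lemma word_act_full:
  assumes "w \<in> words_over gens"
  shows "\<exists>N. \<forall>n\<ge>N. word_act (full n) w \<noteq> None"
proof -
  have "\<exists>t. word_act t w \<noteq> None"
    using assms
  proof (induction w)
    case (Cons x w)
    obtain t where t: "word_act t w \<noteq> None" using Cons by auto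
    obtain g b where x: "x = (g, b)" by force
    obtain s where s: "letter_act s (g, \<not> b) \<noteq> None"
      using letter_act_exists[of "(g, \<not> b)"] Cons.prems x by auto
    obtain M N where "\<forall>n\<ge>M. included t (full n)" "\<forall>n\<ge>N. included s (full n)"
      using included_full by metis
    then have *: "included t (full (M + N))" "included s (full (M + N))" by simp_all
    obtain s' where "letter_act (full (M + N)) (g, \<not> b) = Some s'"
      using included_letter_act[OF _ *(2)] s by blast
    then have "letter_act s' x = Some (full (M + N))"
      using letter_act_inverse x by blast
    then have "word_act s' (x # w) \<noteq> None"
      using included_word_act[OF t *(1)] by simp
    then show ?case by blast
  qed simp
  then show ?thesis using included_word_act included_full by blast
qed

lemma isotopic_word_diagram_context:
  assumes "word_act t (u @ l @ v) \<noteq> None" "word_act t (u @ r @ v) \<noteq> None"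
    and sound: "\<And>s. word_act s l \<noteq> None \<Longrightarrow> word_act s r \<noteq> None \<Longrightarrow>
      word_act s r = word_act s l \<and>
      braid_equivalent (leaf_total (dec s)) (crossings (word_diagram s l)) (crossings (word_diagram s r))"
  shows "isotopic (word_diagram t (u @ l @ v)) (word_diagram t (u @ r @ v))"
proof -
  obtain s where s: "word_act t u = Some s" "word_act s (l @ v) \<noteq> None" "word_act s (r @ v) \<noteq> None"
    using assms(1,2) by (auto simp: word_act_append bind_eq_Some_conv)
  then have lr: "word_act s l \<noteq> None" "word_act s r \<noteq> None"
    by (auto simp: word_act_append bind_eq_Some_conv)
  obtain s' where s': "word_act s l = Some s'" "word_act s r = Some s'" "word_act s' v \<noteq> None"
    using sound[OF lr] lr s by (auto simp: word_act_append)
  \<comment> \<open>Letters preserve the number of strands, so the count at \<open>s\<close>, where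
    \<open>l\<close> is replaced by \<open>r\<close>, agrees with that on the top line.\<close>
  have total: "leaf_total (dec s) = leaf_total (dec t)"
    using s(1)
  proof (induction u arbitrary: t)
    case (Cons x u)
    then obtain t' where "letter_act t x = Some t'" "word_act t' u = Some s"
      by (auto simp: bind_eq_Some_conv)
    moreover have "leaf_total (dec t') = leaf_total (dec t)"
      using calculation(1) leaf_total_gen_act
      by (cases x; cases "snd x") (auto simp: letter_act_False_iff)
    ultimately show ?case using Cons.IH by simp
  qed simp
  have diagram: "word_diagram t (u @ w @ v) = Diagram (positions t)
      (crossings (word_diagram t u) @ crossings (word_diagram s w) @ crossings (word_diagram s' v))
      (bottom_pos (word_diagram s' v))" if "word_act s w = Some s'" for w
    using word_diagram_append[OF s(1), of "w @ v"] word_diagram_append[OF that s'(3)]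
      top_word_diagram[of t u] s(1) s'(3) that
    by (simp add: stack_def word_act_append)
  have "braid_equivalent (card (positions t)) (crossings (word_diagram s l)) (crossings (word_diagram s r))"
    using sound[OF lr] total by (simp add: card_positions)
  then show ?thesis
    using braid_equivalent_context[of "card (positions t)"] diagram[OF s'(1)] diagram[OF s'(2)]
    unfolding braid_equivalent_def by metis
qed

text \<open>Quantifying over all large trees makes this a transitive relation, without having to add
  strands to an isotopy.\<close>

definition eventually_isotopic :: "word \<Rightarrow> word \<Rightarrow> bool" where
  "eventually_isotopic u v \<longleftrightarrow> (\<exists>N. \<forall>n\<ge>N. word_act (full n) u \<noteq> None \<and> word_act (full n) v \<noteq> None \<and>
     isotopic (word_diagram (full n) u) (word_diagram (full n) v))"

lemma eventually_isotopicI: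
  assumes "u \<in> words_over gens" "v \<in> words_over gens"
    "\<And>t. word_act t u \<noteq> None \<Longrightarrow> word_act t v \<noteq> None \<Longrightarrow> isotopic (word_diagram t u) (word_diagram t v)"
  shows "eventually_isotopic u v"
proof -
  obtain M N where "\<forall>n\<ge>M. word_act (full n) u \<noteq> None" "\<forall>n\<ge>N. word_act (full n) v \<noteq> None"
    using word_act_full assms(1,2) by metis
  then show ?thesis
    unfolding eventually_isotopic_def using assms(3) by (intro exI[of _ "M + N"]) auto
qed

lemma equivalent_eventually_isotopic: "u \<simeq> v \<Longrightarrow> eventually_isotopic u v"
  unfolding paren.equivalent_def
proof (induction rule: presentation_cong.induct)
  case (cancel u v x b)
  have "isotopic (word_diagram t (u @ [(x, b), (x, \<not> b)] @ v)) (word_diagram t (u @ [] @ v))"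
    if "word_act t (u @ [(x, b), (x, \<not> b)] @ v) \<noteq> None" "word_act t (u @ [] @ v) \<noteq> None" for t
  proof (rule isotopic_word_diagram_context[OF that])
    fix s assume "word_act s [(x, b), (x, \<not> b)] \<noteq> None"
    from cancel_sound[OF this]
    show "word_act s [] = word_act s [(x, b), (x, \<not> b)] \<and>
        braid_equivalent (leaf_total (dec s)) (crossings (word_diagram s [(x, b), (x, \<not> b)]))
          (crossings (word_diagram s []))"
      by (metis diagram.sel(2) word_act.simps(1) word_diagram.simps(1))
  qed
  then show ?case using cancel by (intro eventually_isotopicI) auto
next
  case (rel u v l r)
  have "isotopic (word_diagram t (u @ l @ v)) (word_diagram t (u @ r @ v))"
    if "word_act t (u @ l @ v) \<noteq> None" "word_act t (u @ r @ v) \<noteq> None" for t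
    by (rule isotopic_word_diagram_context[OF that]) (use relation_sound[OF rel(3)] in blast)
  moreover have "l \<in> words_over gens" "r \<in> words_over gens"
    using rel(3) paren.relators by auto
  ultimately show ?case using rel by (intro eventually_isotopicI) auto
next
  case (refl u)
  then show ?case by (intro eventually_isotopicI) (auto intro: isotopic.refl)
next
  case (sym u v)
  then show ?case unfolding eventually_isotopic_def by (blast intro: isotopic.sym)
next
  case (trans u v w)
  obtain M N where MN:
    "\<forall>n\<ge>M. word_act (full n) u \<noteq> None \<and> word_act (full n) v \<noteq> None \<and>
       isotopic (word_diagram (full n) u) (word_diagram (full n) v)"
    "\<forall>n\<ge>N. word_act (full n) v \<noteq> None \<and> word_act (full n) w \<noteq> None \<and>
       isotopic (word_diagram (full n) v) (word_diagram (full n) w)"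
    using trans.IH unfolding eventually_isotopic_def by blast
  show ?case
    unfolding eventually_isotopic_def
  proof (intro exI[of _ "M + N"] allI impI)
    fix n assume "M + N \<le> n"
    then show "word_act (full n) u \<noteq> None \<and> word_act (full n) w \<noteq> None \<and>
        isotopic (word_diagram (full n) u) (word_diagram (full n) w)"
      using MN isotopic.trans by (meson add_leD1 add_leD2)
  qed
qed

section \<open>The group of parenthesized braids\<close>

text \<open>Distinct words may have the same family of diagrams. One common diagram is enough to
  compare them, since its top line recovers the tree.\<close>

lemma infinite_diagram_eqD:
  assumes "infinite_diagram u = infinite_diagram v" "u \<in> words_over gens"
  shows "u \<simeq> v"
proof -
  obtain t where t: "word_act t u \<noteq> None" using word_act_full[OF assms(2)] by blast
  then have "word_diagram t u \<in> infinite_diagram u"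
    unfolding infinite_diagram_def by blast
  then have "word_diagram t u \<in> infinite_diagram v" by (simp add: assms(1))
  then obtain t' where t': "word_act t' v \<noteq> None" "word_diagram t u = word_diagram t' v"
    by (auto simp: infinite_diagram_def)
  then have "positions t = positions t'"
    using top_word_diagram t by metis
  then have "t = t'" by (rule positions_inj)
  then show ?thesis using isotopic_equivalent t t' isotopic.refl by metis
qed

text \<open>Replaces isotopy on some tree by the congruence on words, which makes the computations
  in the quotient independent of trees.\<close>

lemma infinite_isotopy_iff:
  assumes "u \<in> words_over gens"
  shows "(infinite_diagram u, P) \<in> infinite_isotopy \<longleftrightarrow> (\<exists>v. P = infinite_diagram v \<and> u \<simeq> v)"
proof
  assume "(infinite_diagram u, P) \<in> infinite_isotopy"
  then obtain u' v t where *: "infinite_diagram u = infinite_diagram u'" "P = infinite_diagram v"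
    "word_act t u' \<noteq> None" "word_act t v \<noteq> None" "isotopic (word_diagram t u') (word_diagram t v)"
    by (auto simp: infinite_isotopy_def)
  then have "u \<simeq> u'" "u' \<simeq> v"
    using infinite_diagram_eqD assms isotopic_equivalent by blast+
  then show "\<exists>v. P = infinite_diagram v \<and> u \<simeq> v"
    using * paren.equivalent_trans by blast
next
  assume "\<exists>v. P = infinite_diagram v \<and> u \<simeq> v"
  then obtain v where v: "P = infinite_diagram v" "u \<simeq> v" by blast
  then show "(infinite_diagram u, P) \<in> infinite_isotopy"
    using equivalent_eventually_isotopic[OF v(2)] paren.equivalent_words[OF v(2)]
    unfolding eventually_isotopic_def infinite_isotopy_def by blast
qed

lemma paren_braid_class_eq:
  "u \<in> words_over gens \<Longrightarrow> paren_braid_class u = infinite_diagram ` {v. u \<simeq> v}"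
  by (auto simp: paren_braid_class_def infinite_isotopy_iff)

lemma paren_braid_class_eq_iff:
  assumes "u \<in> words_over gens" "v \<in> words_over gens"
  shows "paren_braid_class u = paren_braid_class v \<longleftrightarrow> u \<simeq> v"
proof
  assume "paren_braid_class u = paren_braid_class v"
  then have "infinite_diagram v \<in> infinite_diagram ` {w. u \<simeq> w}"
    using assms by (auto simp: paren_braid_class_eq)
  then obtain w where "infinite_diagram v = infinite_diagram w" "u \<simeq> w" by blast
  then show "u \<simeq> v"
    using infinite_diagram_eqD assms(2) paren.equivalent_sym paren.equivalent_trans by blast
next
  assume "u \<simeq> v"
  then have "{w. u \<simeq> w} = {w. v \<simeq> w}"
    using paren.equivalent_sym paren.equivalent_trans by blast
  then show "paren_braid_class u = paren_braid_class v"
    using assms by (simp add: paren_braid_class_eq)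
qed

lemma carrier_paren_braid_group: "carrier paren_braid_group = paren_braid_class ` words_over gens"
  by (auto simp: paren_braid_group_def paren_braid_class_def quotient_def infinite_diagrams_def)

lemma mult_paren_braid_class:
  assumes "u \<in> words_over gens" "v \<in> words_over gens"
  shows "paren_braid_class u \<otimes>\<^bsub>paren_braid_group\<^esub> paren_braid_class v = paren_braid_class (u @ v)"
proof -
  have products: "{concatenation P Q |P Q. P \<in> paren_braid_class u \<and> Q \<in> paren_braid_class v}
      = {infinite_diagram (u' @ v') |u' v'. u \<simeq> u' \<and> v \<simeq> v'}" (is "?L = ?R")
    unfolding paren_braid_class_eq[OF assms(1)] paren_braid_class_eq[OF assms(2)]
      concatenation_infinite_diagram[symmetric] by blast
  have "infinite_isotopy `` ?R = infinite_isotopy `` {infinite_diagram (u @ v)}"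
  proof (intro equalityI subsetI)
    fix P assume "P \<in> infinite_isotopy `` ?R"
    then obtain u' v' where *: "u \<simeq> u'" "v \<simeq> v'" "(infinite_diagram (u' @ v'), P) \<in> infinite_isotopy"
      by blast
    have "u @ v \<simeq> u' @ v'" by (rule paren.equivalent_append) fact+
    then show "P \<in> infinite_isotopy `` {infinite_diagram (u @ v)}"
      using * paren.equivalent_words[of "u @ v" "u' @ v'"] assms paren.equivalent_trans
      by (fastforce simp: infinite_isotopy_iff)
  next
    fix P assume "P \<in> infinite_isotopy `` {infinite_diagram (u @ v)}"
    moreover have "infinite_diagram (u @ v) \<in> ?R"
      using assms paren.equivalent_refl by blast
    ultimately show "P \<in> infinite_isotopy `` ?R" by blast
  qed
  then show ?thesis
    using products by (simp add: paren_braid_group_def paren_braid_class_def)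
qed

lemma one_paren_braid_group: "\<one>\<^bsub>paren_braid_group\<^esub> = paren_braid_class []"
  by (simp add: paren_braid_group_def)

lemma group_paren_braid_group: "group paren_braid_group"
proof (rule groupI; (unfold carrier_paren_braid_group one_paren_braid_group)?)
  fix x assume "x \<in> paren_braid_class ` words_over gens"
  then obtain u where u: "u \<in> words_over gens" "x = paren_braid_class u" by blast
  then have "paren_braid_class (word_inv u) \<otimes>\<^bsub>paren_braid_group\<^esub> x = paren_braid_class []"
    by (simp add: mult_paren_braid_class paren_braid_class_eq_iff paren.equivalent_inv_left)
  then show "\<exists>y\<in>paren_braid_class ` words_over gens. y \<otimes>\<^bsub>paren_braid_group\<^esub> x = paren_braid_class []"
    using u by (intro bexI[of _ "paren_braid_class (word_inv u)"]) auto
qed (auto simp: mult_paren_braid_class)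

theorem proposition3p15:
  shows "group presented_paren_group \<and> group paren_braid_group \<and>
    (\<exists>\<phi>. \<phi> \<in> iso presented_paren_group paren_braid_group \<and>
      (\<forall>i\<ge>1. \<phi> (presented_class gens paren_braid_relations [\<sigma> i]) = paren_braid_class [\<sigma> i]) \<and>
      (\<forall>i\<ge>1. \<phi> (presented_class gens paren_braid_relations [\<a> i]) = paren_braid_class [\<a> i]))"
proof -
  let ?cls = "presented_class gens paren_braid_relations"
  \<comment> \<open>A congruence class is a set of words, and its image under
    \<open>infinite_diagram\<close> is already an isotopy class; no representative has to be
    chosen.\<close>
  define \<phi> where "\<phi> A = infinite_diagram ` A" for A
  have \<phi>: "\<phi> (?cls w) = paren_braid_class w" if "w \<in> words_over gens" for w
    using that by (simp add: \<phi>_def presented_class_def paren_braid_class_eq paren.equivalent_def Image_singleton)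
  have "\<phi> \<in> hom presented_paren_group paren_braid_group"
    by (rule homI) (auto simp: presented_paren_group_def paren.carrier_presented_group
      carrier_paren_braid_group paren.mult_presented_class mult_paren_braid_class \<phi>)
  moreover have "bij_betw \<phi> (carrier presented_paren_group) (carrier paren_braid_group)"
    unfolding bij_betw_def presented_paren_group_def paren.carrier_presented_group carrier_paren_braid_group
    by (auto simp: inj_on_def \<phi> paren_braid_class_eq_iff paren.presented_class_eq_iff image_image cong: image_cong_simp)
  ultimately have "\<phi> \<in> iso presented_paren_group paren_braid_group"
    by (simp add: iso_def)
  then show ?thesis
    using \<phi> paren.group_presented_group group_paren_braid_group
    by (auto simp: presented_paren_group_def)
qed

end
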